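(* Let $F$ be a non-degenerate integral quadratic form in $d\ge4$ variables and let $\Omega$ be a compact subset of $V_1(\mathbb{R})=\{\mathbf x\in\mathbb{R}^d:F(\mathbf x)=1\}$. There exist positive numbers $c_1$ and $c_2$, depending only on $\Omega$ and $F$, with the following property. Let $N\geq 1$ be an integer, let $0<r<1$, let $\mathbf q=(q_1,\dots,q_d)$ be a primitive integral vector with $F(\mathbf q)>0$ and $\mathbf q/\sqrt{F(\mathbf q)}\in\Omega$, and let $\nu=(\nu_p)$ and $a=(a_p)$ be sequences indexed by the primes such that: - $\nu_p\ge0$ are integers, $\nu_p=0$ for all but finitely many $p$, and if $\nu_p\neq0$ then $\big(\frac{N}{p}\big)=\big(\frac{F(\mathbf q)}{p}\big)$ (Legendre symbols); - $a_p\in\mathbb{Z}_p$; if $\nu_p\ne0$ then $a_p$ is one of the two solutions of $a_p^2=\frac{N}{F(\mathbf q)}$, and if $\nu_p=0$ then $a_p=0$. Define the global ball $$B_{\mathbf q,\nu,a}:=B_\infty(a_\infty\mathbf q,r)\times\prod_pB_p(a_p\mathbf q,p^{-\nu_p}),\qquad a_\infty=\frac1{\sqrt{F(\mathbf q)}}.$$ If $$|B_{\mathbf q,\nu,a}|\ge c_1\frac{N^{-1/4}}{|\mathbf q|^{1/2}},$$ then there exists a global ball $B'$ inside $B_{\mathbf q,\nu,a}$ with no integral points, whose norm satisfies $$|B'|>c_2\frac{N^{-1/4}}{|\mathbf q|^{1/2}}.$$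
   Context: On $\mathbb{Q}_p^d$ use the norm $\max_i|x_i|_p$; on $\mathbb{R}^d$ fix a norm $|\cdot|$. $B_v(\mathbf o,\rho)$ is the closed ball of center $\mathbf o$ and radius $\rho$ in $\mathbb{Q}_v^d$ ($\mathbb{Q}_\infty=\mathbb{R}$). A global ball is a product $B_\infty(\mathbf b_\infty,\rho)\times\prod_pB_p(\mathbf b_p,p^{-\mu_p})$ with $\mathbf b_\infty\in\mathbb{R}^d$, $\mathbf b_p\in\mathbb{Z}_p^d$, integers $\mu_p\ge0$, and $\mu_p=0$ for all but finitely many $p$; its norm is $\rho\prod_pp^{-\mu_p}$. Global balls are taken with centers on the quadric: $\mathbf b_\infty\in V_1(\mathbb{R})$, and $F(\mathbf b_p)=N$ at primes where $\mu_p>0$. The integral points of a global ball are the $X\in\mathbb{Z}^d$ with $F(X)=N$, $X/\sqrt N\in B_\infty(\mathbf b_\infty,\rho)$ and $X\equiv\mathbf b_p\bmod p^{\mu_p}$ for every prime $p$. A vector is primitive if $\gcd(q_1,\dots,q_d)=1$.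
   Formalization: The formal statement also requires a_p to be a p-adic unit when ν_p≠0; otherwise the claim fails if p divides both N and F(q) (both symbols 0), e.g. F a sum of five squares, q=(2,1,0,0,0), N=5^(2k+1), a_5=5^k, ν_5 slightly below k/2. *)

theory Defs
  imports
    "HOL-Analysis.Analysis"
    "HOL-Number_Theory.Number_Theory"
    "HOL-Algebra.QuotRing"
begin

section \<open>The field of p-adic numbers\<close>

definition padic_abs :: "nat \<Rightarrow> rat \<Rightarrow> real" where
  "padic_abs p x =
     (if x = 0 then 0
      else real p powi (int (multiplicity (int p) (snd (quotient_of x)))
                        - int (multiplicity (int p) (fst (quotient_of x)))))"

definition padic_Cauchy :: "nat \<Rightarrow> (nat \<Rightarrow> rat) \<Rightarrow> bool" where
  "padic_Cauchy p s \<longleftrightarrow> (\<forall>e>0. \<exists>M. \<forall>m\<ge>M. \<forall>n\<ge>M. padic_abs p (s m - s n) < e)"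

definition padic_Cauchy_ring :: "nat \<Rightarrow> (nat \<Rightarrow> rat) ring" where
  "padic_Cauchy_ring p =
     \<lparr>carrier = {s. padic_Cauchy p s},
      mult = (\<lambda>s t n. s n * t n), one = (\<lambda>n. 1),
      zero = (\<lambda>n. 0), add = (\<lambda>s t n. s n + t n)\<rparr>"

definition padic_null :: "nat \<Rightarrow> (nat \<Rightarrow> rat) set" where
  "padic_null p = {s. (\<lambda>n. padic_abs p (s n)) \<longlonglongrightarrow> 0}"

text \<open>
  The field of p-adic numbers is the completion of the rationals for the p-adic absolute value:
  Cauchy sequences modulo null sequences.  All primes have to occur in one statement, so each
  of these fields is a ring structure with a carrier, on one common type of elements.
\<close>

type_synonym padic = "(nat \<Rightarrow> rat) set"

definition Qp :: "nat \<Rightarrow> padic ring" where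
  "Qp p = padic_Cauchy_ring p Quot padic_null p"

definition padic_of_rat :: "nat \<Rightarrow> rat \<Rightarrow> padic" where
  "padic_of_rat p x = padic_null p +>\<^bsub>padic_Cauchy_ring p\<^esub> (\<lambda>n. x)"

abbreviation padic_of_int :: "nat \<Rightarrow> int \<Rightarrow> padic" where
  "padic_of_int p k \<equiv> padic_of_rat p (of_int k)"

text \<open>The limit below does not depend on the representative \<open>s\<close> of the class \<open>x\<close>
  (lemma \<open>padic_norm_eqI\<close>).\<close>

definition padic_norm :: "nat \<Rightarrow> padic \<Rightarrow> real" where
  "padic_norm p x = (THE L. \<forall>s\<in>x. (\<lambda>n. padic_abs p (s n)) \<longlonglongrightarrow> L)"

definition Zp :: "nat \<Rightarrow> padic set" where
  "Zp p = {x \<in> carrier (Qp p). padic_norm p x \<le> 1}"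

definition padic_ball :: "nat \<Rightarrow> padic ^ 'n \<Rightarrow> real \<Rightarrow> (padic ^ 'n) set" where
  "padic_ball p b \<rho> =
     {x. (\<forall>i. x $ i \<in> carrier (Qp p)) \<and>
         Max (range (\<lambda>i. padic_norm p (x $ i \<ominus>\<^bsub>Qp p\<^esub> b $ i))) \<le> \<rho>}"

lemma padic_abs_frac:
  assumes "prime p" "a \<noteq> 0" "b \<noteq> 0"
  shows "padic_abs p (of_int a / of_int b)
           = real p powi (int (multiplicity (int p) b) - int (multiplicity (int p) a))"
proof -
  obtain c d where cd: "quotient_of (of_int a / of_int b) = (c, d)" by (metis surj_pair)
  have d: "d > 0" using quotient_of_denom_pos[OF cd] .
  have eq: "of_int a / of_int b = (of_int c / of_int d :: rat)" using quotient_of_div[OF cd] .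
  hence "(of_int (a * d) :: rat) = of_int (c * b)" using assms d by (simp add: field_simps)
  hence e: "a * d = c * b" by (simp only: of_int_eq_iff)
  have c: "c \<noteq> 0" using e assms d by auto
  have pr: "prime_elem (int p)" using assms(1) by simp
  have "multiplicity (int p) (a * d) = multiplicity (int p) (c * b)" using e by simp
  hence "multiplicity (int p) a + multiplicity (int p) d
           = multiplicity (int p) c + multiplicity (int p) b"
    using assms c d by (simp add: prime_elem_multiplicity_mult_distrib[OF pr])
  thus ?thesis using assms by (simp add: padic_abs_def cd) (smt (verit) of_nat_add)
qed

lemma rat_common_denom:
  fixes x y :: rat
  obtains a b c :: int where "b \<noteq> 0" "x = of_int a / of_int b" "y = of_int c / of_int b"
proof -
  obtain a b where 1: "quotient_of x = (a, b)" by (metis surj_pair)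
  obtain c d where 2: "quotient_of y = (c, d)" by (metis surj_pair)
  have "b > 0" "d > 0" using quotient_of_denom_pos 1 2 by auto
  moreover have "x = of_int a / of_int b" "y = of_int c / of_int d"
    using quotient_of_div 1 2 by auto
  ultimately show ?thesis
    by (intro that[of "b * d" "a * d" "c * b"]) auto
qed

lemma padic_abs_0 [simp]: "padic_abs p 0 = 0"
  by (simp add: padic_abs_def)

lemma padic_abs_nonneg [simp]: "padic_abs p x \<ge> 0"
  by (simp add: padic_abs_def)

lemma padic_abs_eq_0 [simp]: "prime p \<Longrightarrow> padic_abs p x = 0 \<longleftrightarrow> x = 0"
  by (auto simp: padic_abs_def power_int_eq_0_iff prime_gt_0_nat)

lemma padic_abs_1 [simp]: "padic_abs p 1 = 1"
  by (simp add: padic_abs_def)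

lemma padic_abs_minus [simp]: "padic_abs p (- x) = padic_abs p x"
  using multiplicity_times_unit_right[of "-1" "int p" "fst (quotient_of x)"]
  by (simp add: padic_abs_def rat_uminus_code split_def Let_def)

lemma padic_abs_commute: "padic_abs p (x - y) = padic_abs p (y - x)"
  using padic_abs_minus[of p "x - y"] by simp

lemma padic_abs_mult:
  assumes "prime p"
  shows "padic_abs p (x * y) = padic_abs p x * padic_abs p y"
proof (cases "x = 0 \<or> y = 0")
  case False
  obtain a b c where *: "b \<noteq> 0" "x = of_int a / of_int b" "y = of_int c / of_int b"
    by (rule rat_common_denom)
  have nz: "a \<noteq> 0" "c \<noteq> 0" using False * by auto
  have pr: "prime_elem (int p)" using assms by simp
  have p0: "real p \<noteq> 0" using assms by auto
  have "x * y = of_int (a * c) / of_int (b * b)" using * by simp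
  hence "padic_abs p (x * y) = real p powi
     (int (multiplicity (int p) (b * b)) - int (multiplicity (int p) (a * c)))"
    using padic_abs_frac[OF assms, of "a * c" "b * b"] nz * by simp
  also have "\<dots> = padic_abs p x * padic_abs p y"
    using padic_abs_frac[OF assms] nz * p0
    by (simp add: prime_elem_multiplicity_mult_distrib[OF pr] flip: power_int_add)
      (simp add: algebra_simps)
  finally show ?thesis .
qed auto

lemma padic_abs_add:
  assumes "prime p"
  shows "padic_abs p (x + y) \<le> max (padic_abs p x) (padic_abs p y)"
proof (cases "x = 0 \<or> y = 0 \<or> x + y = 0")
  case False
  obtain a b c where *: "b \<noteq> 0" "x = of_int a / of_int b" "y = of_int c / of_int b"
    by (rule rat_common_denom)
  have xy: "x + y = of_int (a + c) / of_int b" using * by (simp add: add_divide_distrib)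
  have nz: "a \<noteq> 0" "c \<noteq> 0" using False * by auto
  have nz': "a + c \<noteq> 0" using False xy by auto
  have p1: "real p \<ge> 1" "prime_elem (int p)" "\<not> is_unit (int p)"
    using assms by (auto simp: prime_ge_Suc_0_nat not_prime_unit)
  define m where "m = min (multiplicity (int p) a) (multiplicity (int p) c)"
  have "int p ^ m dvd a + c"
    unfolding m_def by (intro dvd_add multiplicity_dvd') auto
  hence "m \<le> multiplicity (int p) (a + c)" using nz' p1 by (intro multiplicity_geI) auto
  hence "padic_abs p (x + y) \<le> real p powi (int (multiplicity (int p) b) - int m)"
    unfolding xy using padic_abs_frac[OF assms nz' *(1)] p1
    by (auto intro: power_int_increasing)
  also have "\<dots> \<le> max (padic_abs p x) (padic_abs p y)"
    using padic_abs_frac[OF assms _ *(1)] nz * by (auto simp: m_def min_def)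
  finally show ?thesis .
qed (auto simp: max_def add_eq_0_iff)

lemma padic_abs_triangle:
  "prime p \<Longrightarrow> padic_abs p (x + y) \<le> padic_abs p x + padic_abs p y"
  using padic_abs_add[of p x y] padic_abs_nonneg[of p x] padic_abs_nonneg[of p y] by linarith

lemma padic_abs_triangle3:
  "prime p \<Longrightarrow> \<bar>padic_abs p x - padic_abs p y\<bar> \<le> padic_abs p (x - y)"
  using padic_abs_triangle[of p "x - y" y] padic_abs_triangle[of p "y - x" x]
    padic_abs_commute[of p x y] by auto

lemma padic_Cauchy_const: "padic_Cauchy p (\<lambda>n. x)"
  by (auto simp: padic_Cauchy_def)

lemma padic_Cauchy_convergent:
  assumes "prime p" "padic_Cauchy p s"
  obtains L where "(\<lambda>n. padic_abs p (s n)) \<longlonglongrightarrow> L"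
proof -
  have "Cauchy (\<lambda>n. padic_abs p (s n))"
  proof (rule metric_CauchyI)
    fix e :: real assume "e > 0"
    then obtain M where M: "\<forall>m\<ge>M. \<forall>n\<ge>M. padic_abs p (s m - s n) < e"
      using assms(2) unfolding padic_Cauchy_def by blast
    have "dist (padic_abs p (s m)) (padic_abs p (s n)) < e" if "m \<ge> M" "n \<ge> M" for m n
      using M[rule_format, OF that] padic_abs_triangle3[OF assms(1), of "s m" "s n"]
      by (simp add: dist_real_def)
    thus "\<exists>M. \<forall>m\<ge>M. \<forall>n\<ge>M. dist (padic_abs p (s m)) (padic_abs p (s n)) < e" by blast
  qed
  thus ?thesis using that by (auto simp: Cauchy_convergent_iff convergent_def)
qed

lemma padic_Cauchy_bounded:
  assumes "prime p" "padic_Cauchy p s"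
  obtains K where "K > 0" "\<And>n. padic_abs p (s n) < K"
proof -
  obtain L where "(\<lambda>n. padic_abs p (s n)) \<longlonglongrightarrow> L"
    using padic_Cauchy_convergent[OF assms] .
  hence "Bseq (\<lambda>n. padic_abs p (s n))" by (rule convergent_imp_Bseq[OF convergentI])
  then obtain K where K: "K > 0" "\<And>n. padic_abs p (s n) \<le> K" by (auto simp: Bseq_def)
  have "padic_abs p (s n) < K + 1" for n using K(2)[of n] by simp
  thus ?thesis using that[of "K + 1"] K(1) by simp
qed

lemma padic_Cauchy_add:
  assumes "prime p" "padic_Cauchy p s" "padic_Cauchy p t"
  shows "padic_Cauchy p (\<lambda>n. s n + t n)"
  unfolding padic_Cauchy_def
proof (intro allI impI)
  fix e :: real assume "e > 0"
  then obtain M1 M2 where M: "\<forall>m\<ge>M1. \<forall>n\<ge>M1. padic_abs p (s m - s n) < e"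
    "\<forall>m\<ge>M2. \<forall>n\<ge>M2. padic_abs p (t m - t n) < e"
    using assms(2,3) unfolding padic_Cauchy_def by blast
  have "padic_abs p (s m + t m - (s n + t n)) < e" if "m \<ge> max M1 M2" "n \<ge> max M1 M2" for m n
    using padic_abs_add[OF assms(1), of "s m - s n" "t m - t n"] M(1)[rule_format, of m n]
      M(2)[rule_format, of m n] that by (simp add: add_diff_add)
  thus "\<exists>M. \<forall>m\<ge>M. \<forall>n\<ge>M. padic_abs p (s m + t m - (s n + t n)) < e" by blast
qed

lemma padic_Cauchy_mult:
  assumes "prime p" "padic_Cauchy p s" "padic_Cauchy p t"
  shows "padic_Cauchy p (\<lambda>n. s n * t n)"
  unfolding padic_Cauchy_def
proof (intro allI impI)
  fix e :: real assume e: "e > 0"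
  obtain K where K: "K > 0" "\<And>n. padic_abs p (s n) < K"
    using padic_Cauchy_bounded[OF assms(1,2)] by blast
  obtain L where L: "L > 0" "\<And>n. padic_abs p (t n) < L"
    using padic_Cauchy_bounded[OF assms(1,3)] by blast
  have "e / L > 0" "e / K > 0" using e K(1) L(1) by auto
  then obtain M1 M2 where M: "\<forall>m\<ge>M1. \<forall>n\<ge>M1. padic_abs p (s m - s n) < e / L"
    "\<forall>m\<ge>M2. \<forall>n\<ge>M2. padic_abs p (t m - t n) < e / K"
    using assms(2,3) unfolding padic_Cauchy_def by blast
  have "padic_abs p (s m * t m - s n * t n) < e" if "m \<ge> max M1 M2" "n \<ge> max M1 M2" for m n
  proof -
    have "padic_abs p (s m * (t m - t n)) \<le> K * padic_abs p (t m - t n)"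
      unfolding padic_abs_mult[OF assms(1)] using K(2)[of m] by (intro mult_right_mono) auto
    also have "\<dots> < e" using M(2) that K(1) by (simp add: field_simps)
    finally have 1: "padic_abs p (s m * (t m - t n)) < e" .
    have "padic_abs p (t n * (s m - s n)) \<le> L * padic_abs p (s m - s n)"
      unfolding padic_abs_mult[OF assms(1)] using L(2)[of n] by (intro mult_right_mono) auto
    also have "\<dots> < e" using M(1) that L(1) by (simp add: field_simps)
    finally have 2: "padic_abs p (t n * (s m - s n)) < e" .
    have "s m * t m - s n * t n = s m * (t m - t n) + t n * (s m - s n)"
      by (simp add: algebra_simps)
    thus ?thesis
      using padic_abs_add[OF assms(1), of "s m * (t m - t n)" "t n * (s m - s n)"] 1 2 by simp
  qed
  thus "\<exists>M. \<forall>m\<ge>M. \<forall>n\<ge>M. padic_abs p (s m * t m - s n * t n) < e" by blast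
qed

lemma padic_Cauchy_uminus: "padic_Cauchy p s \<Longrightarrow> padic_Cauchy p (\<lambda>n. - s n)"
proof -
  have "padic_abs p (- s m - - s n) = padic_abs p (s m - s n)" for m n
    using padic_abs_commute[of p "s n" "s m"] by simp
  thus "padic_Cauchy p s \<Longrightarrow> padic_Cauchy p (\<lambda>n. - s n)"
    unfolding padic_Cauchy_def by (simp only:)
qed

lemma padic_null_imp_Cauchy:
  assumes "prime p" "s \<in> padic_null p"
  shows "padic_Cauchy p s"
  unfolding padic_Cauchy_def
proof (intro allI impI)
  fix e :: real assume "e > 0"
  hence "\<forall>\<^sub>F n in sequentially. padic_abs p (s n) < e"
    using assms(2) by (intro order_tendstoD) (auto simp: padic_null_def)
  then obtain M where M: "\<And>n. n \<ge> M \<Longrightarrow> padic_abs p (s n) < e"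
    by (auto simp: eventually_sequentially)
  have "padic_abs p (s m - s n) < e" if "m \<ge> M" "n \<ge> M" for m n
    using padic_abs_add[OF assms(1), of "s m" "- s n"] M[OF that(1)] M[OF that(2)] by simp
  thus "\<exists>M. \<forall>m\<ge>M. \<forall>n\<ge>M. padic_abs p (s m - s n) < e" by blast
qed

lemma cring_padic_Cauchy_ring:
  assumes "prime p"
  shows "cring (padic_Cauchy_ring p)"
proof (intro cringI abelian_groupI comm_monoidI)
  fix x assume "x \<in> carrier (padic_Cauchy_ring p)"
  thus "\<exists>y\<in>carrier (padic_Cauchy_ring p).
          y \<oplus>\<^bsub>padic_Cauchy_ring p\<^esub> x = \<zero>\<^bsub>padic_Cauchy_ring p\<^esub>"
    by (intro bexI[of _ "\<lambda>n. - x n"])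
      (auto simp: padic_Cauchy_ring_def padic_Cauchy_uminus)
qed (auto simp: padic_Cauchy_ring_def padic_Cauchy_const algebra_simps
       intro: padic_Cauchy_add[OF assms] padic_Cauchy_mult[OF assms])

lemma padic_nullI:
  assumes "f \<longlonglongrightarrow> 0" "\<And>n. padic_abs p (s n) \<le> f n"
  shows "s \<in> padic_null p"
proof -
  have "(\<lambda>n. padic_abs p (s n)) \<longlonglongrightarrow> 0"
    by (rule tendsto_sandwich[OF _ _ tendsto_const assms(1)]) (use assms(2) in simp_all)
  thus ?thesis by (simp add: padic_null_def)
qed

lemma padic_null_add:
  assumes "prime p" "s \<in> padic_null p" "t \<in> padic_null p"
  shows "(\<lambda>n. s n + t n) \<in> padic_null p"
proof -
  have "(\<lambda>n. padic_abs p (s n) + padic_abs p (t n)) \<longlonglongrightarrow> 0"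
    using assms(2,3) tendsto_add_zero by (simp add: padic_null_def)
  thus ?thesis by (rule padic_nullI) (rule padic_abs_triangle[OF assms(1)])
qed

lemma padic_null_mult:
  assumes "prime p" "s \<in> padic_null p" "padic_Cauchy p t"
  shows "(\<lambda>n. t n * s n) \<in> padic_null p"
proof -
  obtain K where K: "K > 0" "\<And>n. padic_abs p (t n) < K"
    using padic_Cauchy_bounded[OF assms(1,3)] by blast
  have "(\<lambda>n. K * padic_abs p (s n)) \<longlonglongrightarrow> 0"
    using assms(2) tendsto_mult_right_zero by (simp add: padic_null_def)
  moreover have "padic_abs p (t n * s n) \<le> K * padic_abs p (s n)" for n
    unfolding padic_abs_mult[OF assms(1)] using K(2)[of n] by (intro mult_right_mono) auto
  ultimately show ?thesis by (rule padic_nullI)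
qed

lemma ideal_padic_null:
  assumes "prime p"
  shows "ideal (padic_null p) (padic_Cauchy_ring p)"
proof -
  interpret R: cring "padic_Cauchy_ring p" by (rule cring_padic_Cauchy_ring[OF assms])
  have inv: "\<ominus>\<^bsub>padic_Cauchy_ring p\<^esub> s = (\<lambda>n. - s n)" if "padic_Cauchy p s" for s
    using that by (intro R.minus_equality)
      (auto simp: padic_Cauchy_ring_def padic_Cauchy_uminus)
  show ?thesis
  proof (intro idealI R.ring_axioms)
    show "subgroup (padic_null p) (add_monoid (padic_Cauchy_ring p))"
    proof (intro R.add.subgroupI)
      show "padic_null p \<subseteq> carrier (padic_Cauchy_ring p)"
        using padic_null_imp_Cauchy[OF assms] by (auto simp: padic_Cauchy_ring_def)
      show "padic_null p \<noteq> {}" by (auto simp: padic_null_def intro!: exI[of _ "\<lambda>n. 0"])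
      show "\<ominus>\<^bsub>padic_Cauchy_ring p\<^esub> s \<in> padic_null p" if "s \<in> padic_null p" for s
        using that inv[OF padic_null_imp_Cauchy[OF assms that]] by (simp add: padic_null_def)
    qed (auto simp: padic_Cauchy_ring_def intro: padic_null_add[OF assms])
  next
    fix s t assume "s \<in> padic_null p" "t \<in> carrier (padic_Cauchy_ring p)"
    thus "t \<otimes>\<^bsub>padic_Cauchy_ring p\<^esub> s \<in> padic_null p"
      "s \<otimes>\<^bsub>padic_Cauchy_ring p\<^esub> t \<in> padic_null p"
      using padic_null_mult[OF assms, of s t] by (auto simp: padic_Cauchy_ring_def mult.commute)
  qed
qed

lemma padic_class_eq:
  "padic_null p +>\<^bsub>padic_Cauchy_ring p\<^esub> s = {t. (\<lambda>n. t n - s n) \<in> padic_null p}"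
proof -
  have "t \<in> padic_null p +>\<^bsub>padic_Cauchy_ring p\<^esub> s" if "(\<lambda>n. t n - s n) \<in> padic_null p" for t
    using that unfolding a_r_coset_def' padic_Cauchy_ring_def
    by (auto intro!: bexI[OF _ that])
  thus ?thesis by (auto simp: a_r_coset_def' padic_Cauchy_ring_def)
qed

lemma padic_class_self: "s \<in> padic_null p +>\<^bsub>padic_Cauchy_ring p\<^esub> s"
  unfolding padic_class_eq by (simp add: padic_null_def)

lemma carrier_Qp:
  "carrier (Qp p) = {padic_null p +>\<^bsub>padic_Cauchy_ring p\<^esub> s |s. padic_Cauchy p s}"
  by (auto simp: Qp_def FactRing_def A_RCOSETS_def' padic_Cauchy_ring_def)

lemma padic_norm_eqI:
  assumes "prime p" "x \<in> carrier (Qp p)" "s \<in> x" "(\<lambda>n. padic_abs p (s n)) \<longlonglongrightarrow> L"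
  shows "padic_norm p x = L"
  unfolding padic_norm_def
proof (rule the_equality)
  obtain u where x: "x = {t. (\<lambda>n. t n - u n) \<in> padic_null p}"
    using assms(2) by (auto simp: carrier_Qp padic_class_eq)
  show "\<forall>t\<in>x. (\<lambda>n. padic_abs p (t n)) \<longlonglongrightarrow> L"
  proof
    fix t assume t: "t \<in> x"
    have lim: "(\<lambda>n. padic_abs p (t n - u n) + padic_abs p (s n - u n)) \<longlonglongrightarrow> 0"
      by (rule tendsto_add_zero) (use t assms(3) in \<open>simp_all add: x padic_null_def\<close>)
    have "norm (padic_abs p (t n) - padic_abs p (s n))
                     \<le> padic_abs p (t n - u n) + padic_abs p (s n - u n)" for n
      using padic_abs_triangle3[OF assms(1), of "t n" "s n"]
        padic_abs_triangle[OF assms(1), of "t n - u n" "u n - s n"]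
        padic_abs_commute[of p "u n" "s n"] by simp
    hence "(\<lambda>n. padic_abs p (t n) - padic_abs p (s n)) \<longlonglongrightarrow> 0"
      by (rule Lim_null_comparison[OF always_eventually[OF allI] lim])
    from tendsto_add[OF this assms(4)] show "(\<lambda>n. padic_abs p (t n)) \<longlonglongrightarrow> L" by simp
  qed
  show "M = L" if "\<forall>t\<in>x. (\<lambda>n. padic_abs p (t n)) \<longlonglongrightarrow> M" for M
    by (rule LIMSEQ_unique[OF that[rule_format, OF assms(3)] assms(4)])
qed

lemma padic_of_rat_closed: "padic_of_rat p x \<in> carrier (Qp p)"
  using padic_Cauchy_const[of p x] by (auto simp: carrier_Qp padic_of_rat_def)

lemma padic_norm_of_rat: "prime p \<Longrightarrow> padic_norm p (padic_of_rat p x) = padic_abs p x"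
  by (rule padic_norm_eqI[where s = "\<lambda>n. x"])
    (simp_all add: padic_of_rat_closed, simp add: padic_of_rat_def padic_class_self)

lemma field_Qp:
  assumes p: "prime p"
  shows "field (Qp p)"
proof -
  interpret R: cring "padic_Cauchy_ring p" by (rule cring_padic_Cauchy_ring[OF p])
  interpret I: ideal "padic_null p" "padic_Cauchy_ring p" by (rule ideal_padic_null[OF p])
  interpret Q: cring "Qp p"
    unfolding Qp_def by (rule I.quotient_is_cring[OF R.cring_axioms])
  let ?cl = "\<lambda>s. padic_null p +>\<^bsub>padic_Cauchy_ring p\<^esub> s"
  have hom: "?cl \<in> ring_hom (padic_Cauchy_ring p) (Qp p)"
    unfolding Qp_def by (rule I.rcos_ring_hom)
  have one: "\<one>\<^bsub>Qp p\<^esub> = ?cl (\<lambda>n. 1)"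
    using ring_hom_one[OF hom] by (simp add: padic_Cauchy_ring_def)
  have zero: "\<zero>\<^bsub>Qp p\<^esub> = padic_null p" by (simp add: Qp_def FactRing_def)
  have ne: "\<one>\<^bsub>Qp p\<^esub> \<noteq> \<zero>\<^bsub>Qp p\<^esub>"
  proof
    assume "\<one>\<^bsub>Qp p\<^esub> = \<zero>\<^bsub>Qp p\<^esub>"
    hence "(\<lambda>n. 1) \<in> padic_null p"
      using one zero padic_class_self[of "\<lambda>n. 1" p] by simp
    thus False by (simp add: padic_null_def LIMSEQ_const_iff)
  qed
  show ?thesis
  proof (rule Q.cring_fieldI2[OF ne[symmetric]])
    fix x assume x: "x \<in> carrier (Qp p)" "x \<noteq> \<zero>\<^bsub>Qp p\<^esub>"
    then obtain s where s: "padic_Cauchy p s" "x = ?cl s" by (auto simp: carrier_Qp)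
    obtain L where L: "(\<lambda>n. padic_abs p (s n)) \<longlonglongrightarrow> L"
      using padic_Cauchy_convergent[OF p s(1)] .
    have "L \<noteq> 0"
    proof
      assume "L = 0"
      hence "s \<in> padic_null p" using L by (simp add: padic_null_def)
      hence "x = padic_null p" unfolding s(2) by (rule I.a_rcos_const)
      thus False using x zero by simp
    qed
    moreover have "L \<ge> 0" using L by (intro LIMSEQ_le_const) auto
    ultimately have "L > 0" by simp
    hence "\<forall>\<^sub>F n in sequentially. L / 2 < padic_abs p (s n)"
      using L by (intro order_tendstoD) auto
    then obtain M where M: "\<And>n. n \<ge> M \<Longrightarrow> L / 2 < padic_abs p (s n)"
      by (auto simp: eventually_sequentially)
    have nz: "s n \<noteq> 0" if "n \<ge> M" for n using M[OF that] \<open>L > 0\<close> by auto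
    have inv: "padic_Cauchy p (\<lambda>n. inverse (s n))"
      unfolding padic_Cauchy_def
    proof (intro allI impI)
      fix e :: real assume "e > 0"
      hence "e * (L / 2) * (L / 2) > 0" using \<open>L > 0\<close> by simp
      then obtain K where K: "\<forall>m\<ge>K. \<forall>n\<ge>K. padic_abs p (s m - s n) < e * (L / 2) * (L / 2)"
        using s(1) unfolding padic_Cauchy_def by blast
      have "padic_abs p (inverse (s m) - inverse (s n)) < e"
        if m: "m \<ge> max M K" and n: "n \<ge> max M K" for m n
      proof -
        have "s n - s m = (inverse (s m) - inverse (s n)) * s m * s n"
          using nz m n by (simp add: field_simps)
        hence "padic_abs p (inverse (s m) - inverse (s n)) * padic_abs p (s m) * padic_abs p (s n)
                 = padic_abs p (s n - s m)"
          by (simp only: padic_abs_mult[OF p])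
        also have "\<dots> < e * (L / 2) * (L / 2)" using K m n by simp
        also have "\<dots> \<le> e * padic_abs p (s m) * padic_abs p (s n)"
          using M[of m] M[of n] m n \<open>e > 0\<close> \<open>L > 0\<close> by (intro mult_mono) auto
        finally have "padic_abs p (inverse (s m) - inverse (s n)) * (padic_abs p (s m) * padic_abs p (s n))
                        < e * (padic_abs p (s m) * padic_abs p (s n))" by (simp only: mult.assoc)
        thus ?thesis by (rule mult_right_less_imp_less) simp
      qed
      thus "\<exists>M. \<forall>m\<ge>M. \<forall>n\<ge>M. padic_abs p (inverse (s m) - inverse (s n)) < e" by blast
    qed
    let ?y = "?cl (\<lambda>n. inverse (s n))"
    have y: "?y \<in> carrier (Qp p)" using inv by (auto simp: carrier_Qp)
    have "x \<otimes>\<^bsub>Qp p\<^esub> ?y = ?cl (\<lambda>n. s n * inverse (s n))"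
      using ring_hom_mult[OF hom, of s "\<lambda>n. inverse (s n)"] s inv
      by (simp add: padic_Cauchy_ring_def)
    also have "\<dots> = ?cl (\<lambda>n. 1)"
    proof -
      have *: "(\<lambda>n. s n * inverse (s n) - 1) \<in> padic_null p"
      proof -
        have "\<forall>\<^sub>F n in sequentially. padic_abs p (s n * inverse (s n) - 1) = 0"
          unfolding eventually_sequentially by (rule exI[of _ M]) (simp add: nz)
        thus ?thesis unfolding padic_null_def by (simp add: tendsto_eventually)
      qed
      have "(\<lambda>n. t n - s n * inverse (s n)) \<in> padic_null p \<longleftrightarrow> (\<lambda>n. t n - 1) \<in> padic_null p" for t
      proof
        assume "(\<lambda>n. t n - s n * inverse (s n)) \<in> padic_null p"
        from padic_null_add[OF p this *] show "(\<lambda>n. t n - 1) \<in> padic_null p" by simp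
      next
        assume t: "(\<lambda>n. t n - 1) \<in> padic_null p"
        have "(\<lambda>n. 1 - s n * inverse (s n)) \<in> padic_null p"
          using * by (simp add: padic_null_def padic_abs_commute[of p 1])
        from padic_null_add[OF p t this]
        show "(\<lambda>n. t n - s n * inverse (s n)) \<in> padic_null p" by simp
      qed
      thus ?thesis by (simp add: padic_class_eq)
    qed
    finally show "\<exists>y\<in>carrier (Qp p). x \<otimes>\<^bsub>Qp p\<^esub> y = \<one>\<^bsub>Qp p\<^esub>" using y one by auto
  qed
qed


section \<open>Integral quadratic forms\<close>

text \<open>
  An integral quadratic form is a homogeneous quadratic polynomial with integer coefficients.
  It is given by a square integer matrix \<open>A\<close>, which need not be symmetric:
  \<open>F(x) = (\<Sum>i j. A i j * x i * x j)\<close>, so that odd coefficients of \<open>x i * x j\<close> are possible.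
  The matrix of the associated bilinear form \<open>F(x + y) - F(x) - F(y)\<close> is then \<open>A + transpose A\<close>.
\<close>

definition qform :: "int ^ 'n ^ 'n \<Rightarrow> 'a::comm_ring_1 ^ 'n \<Rightarrow> 'a" where
  "qform A x = (\<Sum>i\<in>UNIV. \<Sum>j\<in>UNIV. of_int (A $ i $ j) * x $ i * x $ j)"

definition qform_padic :: "nat \<Rightarrow> int ^ 'n ^ 'n \<Rightarrow> padic ^ 'n \<Rightarrow> padic" where
  "qform_padic p A x =
     (\<Oplus>\<^bsub>Qp p\<^esub>i\<in>UNIV. \<Oplus>\<^bsub>Qp p\<^esub>j\<in>UNIV.
        padic_of_int p (A $ i $ j) \<otimes>\<^bsub>Qp p\<^esub> x $ i \<otimes>\<^bsub>Qp p\<^esub> x $ j)"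

definition nondegenerate :: "int ^ 'n ^ 'n \<Rightarrow> bool" where
  "nondegenerate A \<longleftrightarrow> det (A + transpose A) \<noteq> 0"

definition V1 :: "int ^ 'n ^ 'n \<Rightarrow> (real ^ 'n) set" where
  "V1 A = {x. qform A x = 1}"

definition real_vec :: "int ^ 'n \<Rightarrow> real ^ 'n" where
  "real_vec X = (\<chi> i. real_of_int (X $ i))"

definition primitive :: "int ^ 'n \<Rightarrow> bool" where
  "primitive q \<longleftrightarrow> Gcd (range (\<lambda>i. q $ i)) = 1"

definition is_norm :: "(real ^ 'n \<Rightarrow> real) \<Rightarrow> bool" where
  "is_norm nrm \<longleftrightarrow>
     (\<forall>x. nrm x \<ge> 0) \<and> (\<forall>x. nrm x = 0 \<longleftrightarrow> x = 0) \<and>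
     (\<forall>c x. nrm (c *\<^sub>R x) = \<bar>c\<bar> * nrm x) \<and> (\<forall>x y. nrm (x + y) \<le> nrm x + nrm y)"

definition real_ball :: "(real ^ 'n \<Rightarrow> real) \<Rightarrow> real ^ 'n \<Rightarrow> real \<Rightarrow> (real ^ 'n) set" where
  "real_ball nrm b \<rho> = {x. nrm (x - b) \<le> \<rho>}"


section \<open>Global balls\<close>

text \<open>
  The data of a global ball: real centre and radius, p-adic centres \<open>b\<^sub>p\<close> and
  exponents \<open>\<mu>\<^sub>p\<close> (the radius at \<open>p\<close> being \<open>p powi -\<mu>\<^sub>p\<close>).  In every family
  indexed by \<open>nat\<close> only the values at primes are used.
\<close>

record ('n::finite) global_ball =
  centre_inf :: "real ^ 'n"
  radius :: real
  centre :: "nat \<Rightarrow> padic ^ 'n"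
  expo :: "nat \<Rightarrow> nat"

definition is_global_ball :: "int ^ 'n ^ 'n \<Rightarrow> nat \<Rightarrow> 'n::finite global_ball \<Rightarrow> bool" where
  "is_global_ball A N B \<longleftrightarrow>
     0 < radius B \<and> finite {p. prime p \<and> expo B p \<noteq> 0} \<and>
     centre_inf B \<in> V1 A \<and>
     (\<forall>p. prime p \<longrightarrow> (\<forall>i. centre B p $ i \<in> Zp p)) \<and>
     (\<forall>p. prime p \<longrightarrow> expo B p > 0 \<longrightarrow> qform_padic p A (centre B p) = padic_of_int p (int N))"

definition ball_set ::
  "(real ^ 'n \<Rightarrow> real) \<Rightarrow> 'n::finite global_ball \<Rightarrow> ((real ^ 'n) \<times> (nat \<Rightarrow> padic ^ 'n)) set" where
  "ball_set nrm B =
     real_ball nrm (centre_inf B) (radius B) \<times>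
     (\<Pi>\<^sub>E p\<in>{p. prime p}. padic_ball p (centre B p) (real p powi (- int (expo B p))))"

definition ball_norm :: "'n::finite global_ball \<Rightarrow> real" where
  "ball_norm B =
     radius B * (\<Prod>p | prime p \<and> expo B p \<noteq> 0. real p powi (- int (expo B p)))"

definition padic_cong :: "nat \<Rightarrow> nat \<Rightarrow> padic \<Rightarrow> padic \<Rightarrow> bool" where
  "padic_cong p m x y \<longleftrightarrow>
     (\<exists>z\<in>Zp p. x \<ominus>\<^bsub>Qp p\<^esub> y = padic_of_int p (int p ^ m) \<otimes>\<^bsub>Qp p\<^esub> z)"

definition integral_points ::
  "int ^ 'n ^ 'n \<Rightarrow> (real ^ 'n \<Rightarrow> real) \<Rightarrow> nat \<Rightarrow> 'n::finite global_ball \<Rightarrow> (int ^ 'n) set" where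
  "integral_points A nrm N B =
     {X. qform A X = int N \<and>
         (1 / sqrt (real N)) *\<^sub>R real_vec X \<in> real_ball nrm (centre_inf B) (radius B) \<and>
         (\<forall>p. prime p \<longrightarrow>
            (\<forall>i. padic_cong p (expo B p) (padic_of_int p (X $ i)) (centre B p $ i)))}"

text \<open>
  The Legendre symbol of \<open>n\<close> at \<open>p\<close> is meant for
  \<open>n\<close> prime to \<open>p\<close>; if both symbols have this meaning, then \<open>a p\<close> is a unit of \<open>Zp p\<close>.
  The library's symbol is 0 if \<open>p\<close> divides \<open>n\<close>, and then 0 = 0 does not exclude that
  \<open>p\<close> divides \<open>a p\<close>, for which the result on holes fails (take for \<open>F\<close> the sum of five squares,
  \<open>q = (2,1,0,0,0)\<close>, \<open>N = 5 ^ (2 * k + 1)\<close>, \<open>\<nu> 5\<close> a little less than \<open>k / 2\<close>, \<open>a 5 = 5 ^ k\<close>).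
  Hence the requirement that \<open>a p\<close> has norm 1; \<open>p\<close> may divide \<open>N\<close> and \<open>F(q)\<close> to the same order.
\<close>

definition admissible ::
  "int ^ 'n ^ 'n \<Rightarrow> nat \<Rightarrow> int ^ 'n \<Rightarrow> (nat \<Rightarrow> nat) \<Rightarrow> (nat \<Rightarrow> padic) \<Rightarrow> bool" where
  "admissible A N q \<nu> a \<longleftrightarrow>
     finite {p. prime p \<and> \<nu> p \<noteq> 0} \<and>
     (\<forall>p. prime p \<longrightarrow>
        a p \<in> Zp p \<and>
        (\<nu> p \<noteq> 0 \<longrightarrow>
           Legendre (int N) (int p) = Legendre (qform A q) (int p) \<and>
           a p [^]\<^bsub>Qp p\<^esub> (2::nat) = padic_of_rat p (of_nat N / of_int (qform A q)) \<and>
           padic_norm p (a p) = 1) \<and>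
        (\<nu> p = 0 \<longrightarrow> a p = \<zero>\<^bsub>Qp p\<^esub>))"

definition ball_at ::
  "int ^ 'n ^ 'n \<Rightarrow> real \<Rightarrow> int ^ 'n \<Rightarrow> (nat \<Rightarrow> nat) \<Rightarrow> (nat \<Rightarrow> padic) \<Rightarrow> 'n::finite global_ball" where
  "ball_at A r q \<nu> a =
     \<lparr>centre_inf = (1 / sqrt (of_int (qform A q))) *\<^sub>R real_vec q,
      radius = r,
      centre = (\<lambda>p. \<chi> i. a p \<otimes>\<^bsub>Qp p\<^esub> padic_of_int p (q $ i)),
      expo = \<nu>\<rparr>"

end

theory Submission
  imports Defs
begin

text \<open>
  Write \<open>F\<close> for the form, \<open>n = F(q)\<close>, \<open>e = q / sqrt n\<close>, and \<open>B(x, y) = F(x + y) - F(x) - F(y)\<close> for the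
  polar form.  Let \<open>M\<close> be the product of the \<open>p ^ \<nu> p\<close>, so that the given ball has norm \<open>r / M\<close>.  The proof
  looks at the values of the single integer \<open>B(X, q)\<close> at the integral points \<open>X\<close> of the ball: the primes
  confine it to one residue class modulo \<open>M\<^sup>2\<close>, and a hole is found where the real place would require
  a value strictly between two consecutive members of this class.

  At a prime \<open>p\<close> with \<open>\<nu> p = m > 0\<close>, the vector \<open>X - a q\<close> is divisible by \<open>p ^ m\<close>, so \<open>F(X - a q)\<close> is
  divisible by \<open>p ^ (2 * m)\<close>.  As \<open>F(X - a q) = N + a\<^sup>2 n - a B(X, q)\<close> and \<open>a\<close> is a unit, \<open>B(X, q)\<close> is fixed
  modulo \<open>p ^ (2 * m)\<close> (\<open>polar_cong_mod_square\<close>).  The modulus is the square of the one that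
  defines the ball, because the tangent space of the quadric at \<open>a q\<close> is orthogonal to \<open>q\<close>.

  At the real place, \<open>x = X / sqrt N\<close> satisfies \<open>F(x - e) = 2 - B(X, q) / sqrt (N n)\<close>.  Hence the height
  \<open>F(x - e)\<close> of an integral point lies in an arithmetic progression with gap \<open>g = M\<^sup>2 / sqrt (N n)\<close>.  The
  height of points of the quadric at distance \<open>s\<close> from \<open>e\<close> is \<open>O(s\<^sup>2)\<close>, and with one of the two signs every
  height \<open>h\<close> is attained at distance \<open>O(sqrt \<bar>h\<bar>)\<close>.  So at distance \<open>O(sqrt g)\<close> from \<open>e\<close> there is a ball
  of radius \<open>\<delta> * sqrt g\<close> in which the heights avoid the progression (\<open>hole_in_quadric\<close>).  Together with
  the unchanged conditions at the primes it is the global ball sought: since \<open>\<Omega>\<close> is compact, \<open>n\<close> and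
  \<open>\<bar>q\<bar>\<^sup>2\<close> are of the same order, and the norm \<open>\<delta> * sqrt g / M\<close> is of the order
  \<open>(N n) powr (-1/4)\<close>, hence of \<open>N powr (-1/4) / \<bar>q\<bar> powr (1/2)\<close>.  The lower bound on the norm of the given
  ball says that \<open>r\<close> exceeds a large multiple of \<open>sqrt g\<close>, which puts the hole inside the ball.
\<close>

section \<open>The polar form\<close>

definition polar :: "int ^ 'n ^ 'n \<Rightarrow> 'a::comm_ring_1 ^ 'n \<Rightarrow> 'a ^ 'n \<Rightarrow> 'a" where
  "polar A x y = (\<Sum>i\<in>UNIV. \<Sum>j\<in>UNIV. of_int (A $ i $ j) * (x $ i * y $ j + y $ i * x $ j))"

lemma qform_add: "qform A (x + y) = qform A x + qform A y + polar A x y"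
  by (simp add: qform_def polar_def sum.distrib [symmetric] algebra_simps)

lemma qform_scale: "qform A (c *s x) = c\<^sup>2 * qform A x"
  by (simp add: qform_def sum_distrib_left power2_eq_square mult_ac)

lemma polar_add_left: "polar A (x + y) z = polar A x z + polar A y z"
  by (simp add: polar_def sum.distrib [symmetric] algebra_simps)

lemma polar_diff_left: "polar A (x - y) z = polar A x z - polar A y z"
  by (simp add: polar_def sum_subtractf [symmetric] algebra_simps)

lemma polar_scale_left: "polar A (c *s x) y = c * polar A x y"
  by (simp add: polar_def sum_distrib_left algebra_simps)

lemma polar_commute: "polar A x y = polar A y x"
  by (simp add: polar_def add.commute mult.commute)

lemma polar_scale_right: "polar A x (c *s y) = c * polar A x y"
  by (simp add: polar_commute [of A x] polar_scale_left)

lemma polar_self: "polar A x x = 2 * qform A x"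
  by (simp add: polar_def qform_def sum_distrib_left mult_ac)

lemma qform_sub_scale:
  "qform A (x - c *s y) = qform A x + c\<^sup>2 * qform A y - c * polar A x y"
proof -
  have "x - c *s y = x + (- c) *s y" by (simp add: vec_eq_iff)
  thus ?thesis by (simp only: qform_add qform_scale polar_scale_right) simp
qed

lemma qform_of_int: "qform A (\<chi> i. of_int (X $ i)) = of_int (qform A X)"
  by (simp add: qform_def)

lemma polar_of_int: "polar A (\<chi> i. of_int (X $ i)) (\<chi> i. of_int (Y $ i)) = of_int (polar A X Y)"
  by (simp add: polar_def)

text \<open>
  The numbers \<open>polar A x (axis k 1)\<close> are the coordinates of \<open>(A + transpose A) *v x\<close>, and this
  matrix is invertible over the reals because its determinant is a nonzero integer.
\<close>

lemma polar_nondegenerate: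
  fixes A :: "int ^ 'n ^ 'n" and x :: "real ^ 'n"
  assumes "nondegenerate A" "\<And>y. polar A x y = 0"
  shows "x = 0"
proof -
  define S :: "real ^ 'n ^ 'n" where "S = (\<chi> i j. of_int (A $ i $ j + A $ j $ i))"
  have "det S = of_int (det (A + transpose A))"
    by (simp add: det_def S_def transpose_def)
  hence "det S \<noteq> 0" using assms(1) by (simp add: nondegenerate_def)
  have "(S *v x) $ k = 0" for k
  proof -
    have "polar A x (axis k 1)
            = (\<Sum>i\<in>UNIV. of_int (A $ i $ k) * x $ i) + (\<Sum>j\<in>UNIV. of_int (A $ k $ j) * x $ j)"
    proof -
      have "polar A x (axis k 1)
              = (\<Sum>i\<in>UNIV. \<Sum>j\<in>UNIV. if j = k then of_int (A $ i $ j) * x $ i else 0)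
              + (\<Sum>i\<in>UNIV. \<Sum>j\<in>UNIV. if i = k then of_int (A $ i $ j) * x $ j else 0)"
        unfolding polar_def sum.distrib [symmetric]
        by (intro sum.cong refl) (simp add: axis_def)
      also have "(\<Sum>i\<in>UNIV. \<Sum>j\<in>UNIV. if i = k then of_int (A $ i $ j) * x $ j else 0)
              = (\<Sum>j\<in>UNIV. \<Sum>i\<in>UNIV. if i = k then of_int (A $ i $ j) * x $ j else 0)"
        by (rule sum.swap)
      finally show ?thesis by simp
    qed
    also have "\<dots> = (S *v x) $ k"
      by (simp add: matrix_vector_mult_def S_def sum.distrib algebra_simps)
    finally show ?thesis using assms(2) by simp
  qed
  hence "S *v x = 0" by (simp add: vec_eq_iff)
  moreover obtain B where "B ** S = mat 1"
    using \<open>det S \<noteq> 0\<close> unfolding invertible_det_nz[symmetric] invertible_def by blast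
  ultimately show "x = 0"
    by (metis matrix_vector_mul_assoc matrix_vector_mul_lid matrix_vector_mult_0_right)
qed

lemma polar_bound:
  fixes A :: "int ^ 'n ^ 'n"
  obtains K where "K > 0" "\<And>x y :: real ^ 'n. \<bar>polar A x y\<bar> \<le> K * (norm x * norm y)"
proof
  let ?K = "1 + (\<Sum>i\<in>UNIV. \<Sum>j\<in>UNIV. 2 * \<bar>of_int (A $ i $ j)\<bar>) :: real"
  have *: "(\<Sum>i\<in>UNIV. \<Sum>j\<in>UNIV. 2 * \<bar>of_int (A $ i $ j)\<bar> :: real) \<ge> 0"
    by (intro sum_nonneg) auto
  thus "?K > 0" by simp
  fix x y :: "real ^ 'n"
  have bd: "\<bar>x $ i * y $ j + y $ i * x $ j\<bar> \<le> 2 * (norm x * norm y)" for i j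
  proof -
    have "\<bar>x $ i * y $ j\<bar> \<le> norm x * norm y" "\<bar>y $ i * x $ j\<bar> \<le> norm y * norm x"
      unfolding abs_mult by (intro mult_mono component_le_norm_cart; simp)+
    thus ?thesis using abs_triangle_ineq[of "x $ i * y $ j" "y $ i * x $ j"]
      by (simp add: mult.commute)
  qed
  have "\<bar>polar A x y\<bar> \<le> (\<Sum>i\<in>UNIV. \<Sum>j\<in>UNIV. \<bar>of_int (A $ i $ j)\<bar> * (2 * (norm x * norm y)))"
    unfolding polar_def
    by (intro order.trans [OF sum_abs] sum_mono)
      (auto simp: abs_mult intro!: mult_left_mono bd)
  also have "\<dots> = (\<Sum>i\<in>UNIV. \<Sum>j\<in>UNIV. 2 * \<bar>of_int (A $ i $ j)\<bar>) * (norm x * norm y)"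
    by (simp add: sum_distrib_left mult_ac)
  also have "\<dots> \<le> ?K * (norm x * norm y)" by (intro mult_right_mono) auto
  finally show "\<bar>polar A x y\<bar> \<le> ?K * (norm x * norm y)" .
qed

section \<open>Norms on real coordinate space\<close>

text \<open>
  A norm is Lipschitz for the Euclidean norm, hence continuous, and its minimum on the compact
  unit sphere is positive.
\<close>

lemma is_norm_equivalent:
  fixes nrm :: "real ^ 'n \<Rightarrow> real"
  assumes "is_norm nrm"
  obtains c C where "c > 0" "C > 0" "\<And>x. c * norm x \<le> nrm x" "\<And>x. nrm x \<le> C * norm x"
proof -
  have nn: "nrm x \<ge> 0" and z: "nrm x = 0 \<longleftrightarrow> x = 0" and sc: "nrm (k *\<^sub>R x) = \<bar>k\<bar> * nrm x"
    and tri: "nrm (x + y) \<le> nrm x + nrm y" for x y k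
    using assms unfolding is_norm_def by auto
  define C where "C = 1 + (\<Sum>i\<in>UNIV. nrm (axis i 1))"
  have C: "C > 0" unfolding C_def using sum_nonneg[of UNIV "\<lambda>i. nrm (axis i 1)"] nn by force
  have sum_le: "nrm (sum f S) \<le> (\<Sum>i\<in>S. nrm (f i))" if "finite S" for f and S :: "'n set"
    using that
  proof (induction S rule: finite_induct)
    case empty
    show ?case using z[of 0] by simp
  next
    case (insert i S)
    show ?case using insert tri[of "f i" "sum f S"] by simp
  qed
  have upper: "nrm x \<le> C * norm x" for x
  proof -
    have "nrm x = nrm (\<Sum>i\<in>UNIV. (x $ i) *\<^sub>R axis i 1)"
      using basis_expansion[of x] by (simp add: scalar_mult_eq_scaleR)
    also have "\<dots> \<le> (\<Sum>i\<in>UNIV. nrm ((x $ i) *\<^sub>R axis i 1))" by (rule sum_le) simp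
    also have "\<dots> \<le> (\<Sum>i\<in>UNIV. norm x * nrm (axis i 1))"
      unfolding sc by (intro sum_mono mult_right_mono component_le_norm_cart nn)
    also have "\<dots> \<le> C * norm x" by (simp add: C_def sum_distrib_left algebra_simps)
    finally show ?thesis .
  qed
  have "\<bar>nrm x - nrm y\<bar> \<le> C * norm (x - y)" for x y
    using tri[of "x - y" y] tri[of "y - x" x] upper[of "x - y"] upper[of "y - x"]
    by (simp add: norm_minus_commute)
  hence cont: "continuous_on S nrm" for S
    using C by (intro lipschitz_on_continuous_on[of C] lipschitz_onI) (auto simp: dist_norm)
  obtain u where u: "u \<in> sphere 0 1" "\<And>y. y \<in> sphere 0 1 \<Longrightarrow> nrm u \<le> nrm y"
    using continuous_attains_inf[OF compact_sphere _ cont, of "0 :: real ^ 'n" 1] by auto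
  have "u \<noteq> 0" using u(1) by auto
  hence pos: "nrm u > 0" using nn[of u] z[of u] by linarith
  have "nrm u * norm x \<le> nrm x" for x
  proof (cases "x = 0")
    case False
    have "nrm u \<le> nrm ((1 / norm x) *\<^sub>R x)" using False by (intro u(2)) simp
    thus ?thesis using False by (simp add: sc field_simps)
  qed (use nn[of 0] in simp)
  thus ?thesis using that[OF pos C] upper by blast
qed

text \<open>
  The lower bound comes from \<open>2 = polar A e e \<le> K * (norm e)\<^sup>2\<close>: the quadric stays away from the
  origin.
\<close>

lemma is_norm_bounds_on_quadric:
  fixes A :: "int ^ 'n ^ 'n" and nrm :: "real ^ 'n \<Rightarrow> real"
  assumes nrm: "is_norm nrm" and cpt: "compact \<Omega>" and sub: "\<Omega> \<subseteq> V1 A"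
  obtains m E where "m > 0" "E > 0" "\<And>e. e \<in> \<Omega> \<Longrightarrow> m \<le> nrm e \<and> nrm e \<le> E"
proof -
  obtain c C where nn: "c > 0" "C > 0" "\<And>x. c * norm x \<le> nrm x" "\<And>x. nrm x \<le> C * norm x"
    using is_norm_equivalent[OF nrm] by blast
  obtain K where K: "K > 0" "\<And>x y :: real ^ 'n. \<bar>polar A x y\<bar> \<le> K * (norm x * norm y)"
    using polar_bound by blast
  obtain R where R: "R > 0" "\<And>e. e \<in> \<Omega> \<Longrightarrow> norm e \<le> R"
    using compact_imp_bounded[OF cpt] unfolding bounded_pos by blast
  show ?thesis
  proof
    show "c * sqrt (2 / K) > 0" "C * R > 0" using nn K R by auto
    fix e assume e: "e \<in> \<Omega>"
    hence "2 \<le> K * (norm e * norm e)" using K(2)[of e e] sub by (auto simp: polar_self V1_def)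
    hence "sqrt (2 / K) \<le> norm e"
      using K(1) by (intro real_le_lsqrt) (auto simp: field_simps power2_eq_square)
    thus "c * sqrt (2 / K) \<le> nrm e \<and> nrm e \<le> C * R"
      using nn(3)[of e] nn(4)[of e] R(2)[OF e] nn(1,2)
      by (meson mult_left_mono less_imp_le order_trans)
  qed
qed

section \<open>Holes in the real quadric\<close>

text \<open>
  If the form vanished on the hyperplane orthogonal to \<open>e\<close>, then so would its polar form; the
  projection of any \<open>x\<close> to this hyperplane would be orthogonal to the hyperplane and to \<open>e\<close>, thus
  be \<open>0\<close> by nondegeneracy.  Then \<open>e\<close> would span the whole space.
\<close>

lemma qform_nonzero_on_complement:
  fixes A :: "int ^ 'n ^ 'n" and e :: "real ^ 'n"
  assumes card: "CARD('n) \<ge> 2" and nd: "nondegenerate A" and e: "qform A e = 1"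
  shows "\<exists>w. polar A w e = 0 \<and> qform A w \<noteq> 0"
proof (rule ccontr)
  assume "\<not> ?thesis"
  hence iso: "qform A w = 0" if "polar A w e = 0" for w using that by blast
  have "\<exists>x. x \<notin> span {e}"
  proof (rule ccontr)
    assume "\<nexists>x. x \<notin> span {e}"
    hence "span {e} = UNIV" by auto
    moreover have "dim (span {e}) \<le> 1" using dim_le_card[of "{e}" "{e}"] by (simp add: span_superset)
    ultimately show False using card by (simp add: dim_UNIV)
  qed
  then obtain x where x: "x \<notin> span {e}" by blast
  define P where "P y = y - (polar A y e / 2) *s e" for y :: "real ^ 'n"
  have P: "polar A (P y) e = 0" for y
    by (simp add: P_def polar_diff_left polar_scale_left polar_self e)
  \<comment> \<open>Split \<open>y\<close> into \<open>P y\<close> and a multiple of \<open>e\<close>.\<close>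
  have "polar A (P x) y = 0" for y
  proof -
    have "polar A (P x + P y) e = 0" by (simp add: polar_add_left P)
    from iso[OF this] have "polar A (P x) (P y) = 0"
      by (simp add: qform_add iso P)
    hence 0: "polar A (P y) (P x) = 0" by (simp add: polar_commute[of A "P x"])
    have "y = P y + (polar A y e / 2) *s e" by (simp add: P_def vector_scalar_mult_def vec_eq_iff)
    hence "polar A y (P x) = polar A (P y + (polar A y e / 2) *s e) (P x)" by simp
    also have "\<dots> = 0"
      by (simp add: polar_add_left polar_scale_left 0 polar_commute[of A e] P)
    finally show ?thesis by (simp add: polar_commute[of A "P x"])
  qed
  hence "P x = 0" by (rule polar_nondegenerate[OF nd])
  hence "x = (polar A x e / 2) *s e" by (simp add: P_def vector_scalar_mult_def vec_eq_iff)
  hence "x \<in> span {e}" by (metis scalar_mult_eq_scaleR span_base span_mul singletonI)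
  thus False using x by simp
qed

lemma continuous_on_qform [continuous_intros]:
  "continuous_on S f \<Longrightarrow> continuous_on S (\<lambda>x. qform A (f x :: real ^ 'n))"
  unfolding qform_def by (intro continuous_intros)

lemma continuous_on_polar [continuous_intros]:
  "continuous_on S f \<Longrightarrow> continuous_on S g \<Longrightarrow> continuous_on S (\<lambda>x. polar A (f x :: real ^ 'n) (g x))"
  unfolding polar_def by (intro continuous_intros)

text \<open>
  Compactness makes the choice of a non-isotropic \<open>w\<close> orthogonal to \<open>e\<close> uniform in \<open>e\<close>: writing
  \<open>P e y\<close> for the projection of \<open>y\<close> to the hyperplane orthogonal to \<open>e\<close>, the sets \<open>U k\<close> of those \<open>e\<close>
  for which some \<open>w = P e y\<close> satisfies the bound with constant \<open>k\<close> are open, and they cover \<open>\<Omega>\<close>.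
\<close>

lemma complement_direction_uniform:
  fixes A :: "int ^ 'n ^ 'n"
  assumes card: "CARD('n) \<ge> 2" and nd: "nondegenerate A"
    and cpt: "compact \<Omega>" and sub: "\<Omega> \<subseteq> V1 A"
  obtains C where "C > 0"
    "\<And>e. e \<in> \<Omega> \<Longrightarrow> \<exists>w. polar A w e = 0 \<and> qform A w \<noteq> 0 \<and> (norm w)\<^sup>2 \<le> C * \<bar>qform A w\<bar>"
proof -
  define P where "P e y = y - (polar A y e / 2) *s e" for e y :: "real ^ 'n"
  define U where "U k = (\<Union>y. {e. (norm (P e y))\<^sup>2 < real k * \<bar>qform A (P e y)\<bar>})" for k :: nat
  have PV: "polar A (P e y) e = 0" if "qform A e = 1" for e y
    using that by (simp add: P_def polar_diff_left polar_scale_left polar_self)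
  have "open (U k)" for k
    unfolding U_def P_def scalar_mult_eq_scaleR by (intro open_UN ballI open_Collect_less continuous_intros) simp_all
  moreover have "\<Omega> \<subseteq> (\<Union>k. U k)"
  proof
    fix e assume "e \<in> \<Omega>"
    hence e: "qform A e = 1" using sub by (auto simp: V1_def)
    obtain w where w: "polar A w e = 0" "qform A w \<noteq> 0"
      using qform_nonzero_on_complement[OF card nd e] by blast
    obtain k :: nat where "(norm w)\<^sup>2 / \<bar>qform A w\<bar> < real k" using reals_Archimedean2 by blast
    hence "e \<in> U k" using w by (auto simp: U_def P_def field_simps intro!: exI[of _ w])
    thus "e \<in> (\<Union>k. U k)" by blast
  qed
  ultimately obtain T where T: "finite T" "\<Omega> \<subseteq> (\<Union>k\<in>T. U k)"
    using compactE_image[OF cpt, of UNIV U] by auto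
  define C where "C = 1 + real (Max (insert 0 T))"
  show ?thesis
  proof
    show "C > 0" by (simp add: C_def)
    fix e assume e: "e \<in> \<Omega>"
    then obtain k y where k: "k \<in> T" and
      y: "(norm (P e y))\<^sup>2 < real k * \<bar>qform A (P e y)\<bar>" using T(2) by (auto simp: U_def)
    have "k \<le> Max (insert 0 T)" using k T(1) by simp
    hence "real k * \<bar>qform A (P e y)\<bar> \<le> C * \<bar>qform A (P e y)\<bar>"
      by (intro mult_right_mono) (auto simp: C_def)
    hence "(norm (P e y))\<^sup>2 \<le> C * \<bar>qform A (P e y)\<bar>" using y by linarith
    moreover have "qform A (P e y) \<noteq> 0" using y by (auto simp: zero_le_power2 not_less)
    ultimately show "\<exists>w. polar A w e = 0 \<and> qform A w \<noteq> 0 \<and> (norm w)\<^sup>2 \<le> C * \<bar>qform A w\<bar>"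
      using PV[of e y] e sub by (intro exI[of _ "P e y"]) (auto simp: V1_def)
  qed
qed

text \<open>
  The point is \<open>b = (1 - h / 2) e + u\<close> with \<open>u\<close> orthogonal to \<open>e\<close>: both \<open>qform A b = 1\<close> and
  \<open>qform A (b - e) = h\<close> amount to \<open>qform A u = h - h\<^sup>2 / 4\<close>.  Such a \<open>u\<close> is found on the line through a
  non-isotropic \<open>w\<close> if \<open>h\<close> has the sign of \<open>qform A w\<close>, and this is the reason for \<open>\<sigma>\<close>: if the form is
  definite on the hyperplane orthogonal to \<open>e\<close>, then only one sign of \<open>h\<close> occurs near \<open>e\<close>.
  The length of \<open>u\<close> is of order \<open>sqrt \<bar>h\<bar>\<close>, because the form is quadratic.
\<close>

lemma quadric_point_at_height:
  fixes A :: "int ^ 'n ^ 'n"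
  assumes card: "CARD('n) \<ge> 2" and nd: "nondegenerate A"
    and cpt: "compact \<Omega>" and sub: "\<Omega> \<subseteq> V1 A"
  obtains C where "C > 0"
    "\<And>e. e \<in> \<Omega> \<Longrightarrow> \<exists>\<sigma>\<in>{1, -1 :: real}. \<forall>h. 0 < \<sigma> * h \<and> \<bar>h\<bar> \<le> 2 \<longrightarrow>
       (\<exists>b\<in>V1 A. qform A (b - e) = h \<and> norm (b - e) \<le> C * sqrt \<bar>h\<bar>)"
proof -
  obtain C where C: "C > 0" "\<And>e. e \<in> \<Omega> \<Longrightarrow>
      \<exists>w. polar A w e = 0 \<and> qform A w \<noteq> 0 \<and> (norm w)\<^sup>2 \<le> C * \<bar>qform A w\<bar>"
    using complement_direction_uniform[OF assms] by blast
  obtain R where R: "R > 0" "\<And>e. e \<in> \<Omega> \<Longrightarrow> norm e \<le> R"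
    using compact_imp_bounded[OF cpt] unfolding bounded_pos by blast
  show ?thesis
  proof
    show "R + sqrt (2 * C) > 0" using R C by (simp add: add_pos_nonneg)
    fix e assume e\<Omega>: "e \<in> \<Omega>"
    hence e: "qform A e = 1" using sub by (auto simp: V1_def)
    obtain w where w: "polar A w e = 0" "qform A w \<noteq> 0" "(norm w)\<^sup>2 \<le> C * \<bar>qform A w\<bar>"
      using C(2)[OF e\<Omega>] by blast
    show "\<exists>\<sigma>\<in>{1, -1 :: real}. \<forall>h. 0 < \<sigma> * h \<and> \<bar>h\<bar> \<le> 2 \<longrightarrow>
       (\<exists>b\<in>V1 A. qform A (b - e) = h \<and> norm (b - e) \<le> (R + sqrt (2 * C)) * sqrt \<bar>h\<bar>)"
    proof (intro bexI[of _ "sgn (qform A w)"] allI impI)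
      show "sgn (qform A w) \<in> {1, -1 :: real}" using w(2) by (auto simp: sgn_if)
      fix h :: real assume h: "0 < sgn (qform A w) * h \<and> \<bar>h\<bar> \<le> 2"
      define y where "y = h * (1 - h / 4)"
      have y: "\<bar>y\<bar> \<le> 2 * \<bar>h\<bar>"
        unfolding y_def abs_mult using h by (subst mult.commute) (intro mult_right_mono, auto)
      have "h \<noteq> 0" "0 < 1 - h / 4" using h by auto
      have ratio: "y / qform A w > 0"
        using h w(2) \<open>0 < 1 - h / 4\<close>
        by (auto simp: y_def sgn_if zero_less_divide_iff zero_less_mult_iff mult_less_0_iff split: if_splits)
      define u where "u = sqrt (y / qform A w) *s w"
      have u: "polar A u e = 0" "qform A u = y"
        using w ratio by (simp_all add: u_def polar_scale_left qform_scale)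
      have "(norm u)\<^sup>2 = (y / qform A w) * (norm w)\<^sup>2"
        using ratio by (simp add: u_def scalar_mult_eq_scaleR power_mult_distrib)
      also have "\<dots> \<le> (y / qform A w) * (C * \<bar>qform A w\<bar>)"
        using ratio w(3) by (intro mult_left_mono) auto
      also have "\<dots> = C * \<bar>y\<bar>"
      proof -
        have "\<bar>y\<bar> = (y / qform A w) * \<bar>qform A w\<bar>"
          using ratio w(2) by (metis abs_divide abs_of_pos nonzero_eq_divide_eq abs_eq_0)
        thus ?thesis by simp
      qed
      also have "\<dots> \<le> C * (2 * \<bar>h\<bar>)" using y C(1) by simp
      finally have "norm u \<le> sqrt (2 * C * \<bar>h\<bar>)" by (intro real_le_rsqrt) simp
      hence nu: "norm u \<le> sqrt (2 * C) * sqrt \<bar>h\<bar>" by (simp add: real_sqrt_mult)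
      define b where "b = (1 - h / 2) *s e + u"
      have be: "b - e = (- h / 2) *s e + u"
        by (simp add: b_def vec_eq_iff algebra_simps)
      have eu: "polar A e u = 0" using u(1) by (simp add: polar_commute)
      have "qform A b = (1 - h / 2)\<^sup>2 + y"
        by (simp only: b_def qform_add qform_scale polar_scale_left eu u e mult_zero_right mult_1_right add_0_right)
      hence "qform A b = 1" by (simp add: y_def power2_eq_square field_simps)
      moreover have "qform A (b - e) = (- h / 2)\<^sup>2 + y"
        by (simp only: be qform_add qform_scale polar_scale_left eu u e mult_zero_right mult_1_right add_0_right)
      hence "qform A (b - e) = h" by (simp add: y_def power2_eq_square field_simps)
      moreover have "norm (b - e) \<le> (R + sqrt (2 * C)) * sqrt \<bar>h\<bar>"
      proof -
        have "\<bar>h\<bar> / 2 \<le> sqrt \<bar>h\<bar>"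
        proof -
          have "\<bar>h\<bar> * \<bar>h\<bar> \<le> 2 * \<bar>h\<bar>" using h by (intro mult_right_mono) auto
          hence "(\<bar>h\<bar> / 2)\<^sup>2 \<le> \<bar>h\<bar>" by (simp add: power2_eq_square)
          thus ?thesis by (rule real_le_rsqrt)
        qed
        hence "\<bar>h\<bar> / 2 * norm e \<le> sqrt \<bar>h\<bar> * R"
          using R(2)[OF e\<Omega>] by (intro mult_mono) auto
        moreover have "norm ((- h / 2) *s e) = \<bar>h\<bar> / 2 * norm e"
          by (simp add: scalar_mult_eq_scaleR)
        ultimately show ?thesis unfolding be
          using norm_triangle_ineq[of "(- h / 2) *s e" u] nu by (simp add: algebra_simps)
      qed
      ultimately show "\<exists>b\<in>V1 A. qform A (b - e) = h \<and> norm (b - e) \<le> (R + sqrt (2 * C)) * sqrt \<bar>h\<bar>"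
        by (intro bexI[of _ b]) (auto simp: V1_def)
    qed
  qed
qed

text \<open>
  On either side of zero, some midpoint of a gap of the progression \<open>t + g * k\<close> has absolute value
  between \<open>g\<close> and \<open>2 * g\<close>.
\<close>

lemma midpoint_near_zero:
  fixes t g \<sigma> :: real
  assumes "g > 0" "\<sigma> \<in> {1, -1}"
  obtains k :: int where "g \<le> \<sigma> * (t + g * (of_int k + 1/2))" "\<sigma> * (t + g * (of_int k + 1/2)) \<le> 2 * g"
proof -
  define j :: int where "j = \<lceil>1/2 - \<sigma> * t / g\<rceil>"
  have "1/2 - \<sigma> * t / g \<le> of_int j" "of_int j \<le> 3/2 - \<sigma> * t / g" unfolding j_def by linarith+
  hence j: "g \<le> \<sigma> * t + g * (of_int j + 1/2)" "\<sigma> * t + g * (of_int j + 1/2) \<le> 2 * g"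
    using assms(1) by (simp_all add: field_simps)
  show ?thesis
  proof (cases "\<sigma> = 1")
    case True
    show ?thesis by (rule that[of j]) (use j True in simp_all)
  next
    case False
    hence "\<sigma> = -1" using assms(2) by simp
    show ?thesis by (rule that[of "- j - 1"]) (use j \<open>\<sigma> = -1\<close> in \<open>simp_all add: algebra_simps\<close>)
  qed
qed

text \<open>
  The centre \<open>b\<close> is taken at a height \<open>h = qform A (b - e)\<close> in the middle of a gap of the progression
  \<open>t + g * k\<close>, with \<open>\<bar>h\<bar> \<le> 2 * g\<close>, so that \<open>b\<close> is at distance \<open>O(sqrt g)\<close> from \<open>e\<close>.  Around a point
  that close to \<open>e\<close> the height moves by at most \<open>O(\<delta> * g)\<close> in a ball of radius \<open>\<delta> * sqrt g\<close>; with \<open>\<delta>\<close>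
  small it stays inside the gap.
\<close>

lemma hole_in_quadric:
  fixes A :: "int ^ 'n ^ 'n" and nrm :: "real ^ 'n \<Rightarrow> real"
  assumes card: "CARD('n) \<ge> 2" and nd: "nondegenerate A" and nrm: "is_norm nrm"
    and cpt: "compact \<Omega>" and sub: "\<Omega> \<subseteq> V1 A"
  obtains C \<delta> where "C > 0" "\<delta> > 0"
    "\<And>e g t. e \<in> \<Omega> \<Longrightarrow> 0 < g \<Longrightarrow> g \<le> 1 \<Longrightarrow>
       \<exists>b\<in>V1 A. nrm (b - e) \<le> C * sqrt g \<and>
         (\<forall>x k. nrm (x - b) \<le> \<delta> * sqrt g \<longrightarrow> qform A (x - e) \<noteq> t + g * of_int k)"
proof -
  obtain C1 where C1: "C1 > 0"
    "\<And>e. e \<in> \<Omega> \<Longrightarrow> \<exists>\<sigma>\<in>{1, -1 :: real}. \<forall>h. 0 < \<sigma> * h \<and> \<bar>h\<bar> \<le> 2 \<longrightarrow>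
       (\<exists>b\<in>V1 A. qform A (b - e) = h \<and> norm (b - e) \<le> C1 * sqrt \<bar>h\<bar>)"
    using quadric_point_at_height[OF card nd cpt sub] by blast
  obtain c C2 where nn: "c > 0" "C2 > 0" "\<And>x. c * norm x \<le> nrm x" "\<And>x. nrm x \<le> C2 * norm x"
    using is_norm_equivalent[OF nrm] by blast
  obtain K where K: "K > 0" "\<And>x y :: real ^ 'n. \<bar>polar A x y\<bar> \<le> K * (norm x * norm y)"
    using polar_bound by blast
  define D where "D = C1 * sqrt 2"
  have D: "D > 0" using C1 by (simp add: D_def)
  \<comment> \<open>With this \<open>\<eta>\<close> the height varies by at most a quarter of the gap, half of what is available.\<close>
  define \<eta> where "\<eta> = min 1 (1 / (4 * (K * (D + 1))))"
  have \<eta>: "\<eta> > 0" "\<eta> \<le> 1" using K D by (simp_all add: \<eta>_def)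
  have "K * (D + 1) * \<eta> \<le> K * (D + 1) * (1 / (4 * (K * (D + 1))))"
    using K D by (intro mult_left_mono) (auto simp: \<eta>_def)
  also have "\<dots> = 1/4"
  proof -
    have "K * (D + 1) \<noteq> 0" using K D by simp
    thus ?thesis by (simp only: nonzero_mult_div_cancel_left times_divide_eq_right mult_1_right) simp
  qed
  finally have \<eta>K: "K * (D + 1) * \<eta> \<le> 1/4" .
  show ?thesis
  proof
    show "C2 * D > 0" "c * \<eta> > 0" using nn D \<eta> by simp_all
    fix e t and g :: real assume e: "e \<in> \<Omega>" and g: "0 < g" "g \<le> 1"
    obtain \<sigma> :: real where \<sigma>: "\<sigma> \<in> {1, -1}" "\<And>h. 0 < \<sigma> * h \<Longrightarrow> \<bar>h\<bar> \<le> 2 \<Longrightarrow>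
       (\<exists>b\<in>V1 A. qform A (b - e) = h \<and> norm (b - e) \<le> C1 * sqrt \<bar>h\<bar>)"
      using C1(2)[OF e] by blast
    obtain k0 :: int where k0: "g \<le> \<sigma> * (t + g * (of_int k0 + 1/2))"
      "\<sigma> * (t + g * (of_int k0 + 1/2)) \<le> 2 * g" using midpoint_near_zero[OF g(1) \<sigma>(1)] by blast
    define h where "h = t + g * (of_int k0 + 1/2)"
    have h: "0 < \<sigma> * h" "\<bar>h\<bar> \<le> 2 * g" using k0 g(1) \<sigma>(1) unfolding h_def[symmetric] by auto
    obtain b where b: "b \<in> V1 A" "qform A (b - e) = h" "norm (b - e) \<le> C1 * sqrt \<bar>h\<bar>"
      using \<sigma>(2)[OF h(1)] h(2) g(2) by auto
    have "sqrt \<bar>h\<bar> \<le> sqrt 2 * sqrt g" using h(2) by (simp flip: real_sqrt_mult)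
    hence be: "norm (b - e) \<le> D * sqrt g"
      using b(3) C1(1) by (simp add: D_def mult.assoc) (meson mult_left_mono less_imp_le order_trans)
    have close: "nrm (b - e) \<le> C2 * D * sqrt g"
      unfolding mult.assoc by (rule order_trans[OF nn(4) mult_left_mono[OF be less_imp_le[OF nn(2)]]])
    have avoid: "qform A (x - e) \<noteq> t + g * of_int k" if x: "nrm (x - b) \<le> c * \<eta> * sqrt g" for x k
    proof
      assume eq: "qform A (x - e) = t + g * of_int k"
      have "c * norm (x - b) \<le> c * (\<eta> * sqrt g)" using nn(3)[of "x - b"] x by (simp add: mult.assoc)
      hence xb: "norm (x - b) \<le> \<eta> * sqrt g" using nn(1) by simp
      have "\<bar>polar A (x - b) (b - e)\<bar> \<le> K * ((\<eta> * sqrt g) * (D * sqrt g))"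
        using K(1) \<eta> g(1) by (intro order_trans[OF K(2)] mult_left_mono mult_mono xb be) auto
      hence 1: "\<bar>polar A (x - b) (b - e)\<bar> \<le> K * D * \<eta> * g" using g(1) by (simp add: mult_ac)
      have "\<bar>polar A (x - b) (x - b)\<bar> \<le> K * ((\<eta> * sqrt g) * (1 * sqrt g))"
        using K(1) \<eta> g(1) by (intro order_trans[OF K(2)] mult_left_mono mult_mono xb
          order_trans[OF xb mult_right_mono]) auto
      hence 2: "2 * \<bar>qform A (x - b)\<bar> \<le> K * \<eta> * g"
        using g(1) by (simp add: polar_self abs_mult mult_ac)
      have "qform A (x - e) = qform A (x - b) + h + polar A (x - b) (b - e)"
        using qform_add[of A "x - b" "b - e"] b(2) by simp
      hence "\<bar>qform A (x - e) - h\<bar> \<le> (K * (D + 1) * \<eta>) * g"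
        using 1 2 by (simp add: algebra_simps abs_if split: if_splits)
      also have "\<dots> \<le> 1/4 * g" using \<eta>K g(1) by (intro mult_right_mono) auto
      finally have "\<bar>g * (of_int k - of_int k0 - 1/2)\<bar> \<le> g * (1/4)"
        unfolding eq h_def by (simp add: algebra_simps)
      hence "\<bar>of_int k - of_int k0 - 1/2 :: real\<bar> \<le> 1/4"
        using g(1) by (simp only: abs_mult abs_of_pos mult_le_cancel_left_pos)
      hence "0 < k - k0" "k - k0 < 1" by linarith+
      thus False by simp
    qed
    show "\<exists>b\<in>V1 A. nrm (b - e) \<le> C2 * D * sqrt g \<and>
         (\<forall>x k. nrm (x - b) \<le> c * \<eta> * sqrt g \<longrightarrow> qform A (x - e) \<noteq> t + g * of_int k)"
      using b(1) close avoid by blast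
  qed
qed

section \<open>p-adic numbers by representatives\<close>

abbreviation padic_class :: "nat \<Rightarrow> (nat \<Rightarrow> rat) \<Rightarrow> padic" where
  "padic_class p s \<equiv> padic_null p +>\<^bsub>padic_Cauchy_ring p\<^esub> s"

text \<open>
  Elements of \<open>Qp p\<close> are handled through Cauchy sequences representing them: the operations of
  \<open>Qp p\<close> act on representatives termwise, and the norm is the limit of the absolute values of the terms.
  In this way a computation in \<open>Qp p\<close> becomes one with rational numbers.
\<close>

lemma padic_class_ring_hom:
  assumes "prime p"
  shows "padic_class p \<in> ring_hom (padic_Cauchy_ring p) (Qp p)"
  unfolding Qp_def by (rule ideal.rcos_ring_hom[OF ideal_padic_null[OF assms]])

lemma padic_class_eq_iff:
  assumes "prime p"
  shows "padic_class p s = padic_class p t \<longleftrightarrow> (\<lambda>k. s k - t k) \<in> padic_null p"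
proof
  assume "padic_class p s = padic_class p t"
  thus "(\<lambda>k. s k - t k) \<in> padic_null p" using padic_class_self[of s p] by (simp add: padic_class_eq)
next
  assume st: "(\<lambda>k. s k - t k) \<in> padic_null p"
  hence ts: "(\<lambda>k. t k - s k) \<in> padic_null p"
    by (simp add: padic_null_def padic_abs_commute[of p "t _"])
  show "padic_class p s = padic_class p t"
  proof -
    have "(\<lambda>k. u k - s k) \<in> padic_null p \<longleftrightarrow> (\<lambda>k. u k - t k) \<in> padic_null p" for u
      using padic_null_add[OF assms _ st, of "\<lambda>k. u k - s k"]
        padic_null_add[OF assms _ ts, of "\<lambda>k. u k - t k"] by auto
    thus ?thesis by (simp add: padic_class_eq)
  qed
qed

lemma padic_class_mult:
  assumes "prime p" "padic_Cauchy p s" "padic_Cauchy p t"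
  shows "padic_class p s \<otimes>\<^bsub>Qp p\<^esub> padic_class p t = padic_class p (\<lambda>k. s k * t k)"
  using ring_hom_mult[OF padic_class_ring_hom[OF assms(1)], of s t] assms(2,3)
  by (simp add: padic_Cauchy_ring_def)

lemma padic_class_diff:
  assumes p: "prime p" and s: "padic_Cauchy p s" and t: "padic_Cauchy p t"
  shows "padic_class p s \<ominus>\<^bsub>Qp p\<^esub> padic_class p t = padic_class p (\<lambda>k. s k - t k)"
proof -
  interpret field "Qp p" by (rule field_Qp[OF p])
  have d: "padic_Cauchy p (\<lambda>k. s k - t k)"
    using padic_Cauchy_add[OF p s padic_Cauchy_uminus[OF t]] by simp
  have cl: "padic_class p u \<in> carrier (Qp p)" if "padic_Cauchy p u" for u
    using that by (auto simp: carrier_Qp)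
  have "padic_class p (\<lambda>k. s k - t k) \<oplus>\<^bsub>Qp p\<^esub> padic_class p t = padic_class p s"
    using ring_hom_add[OF padic_class_ring_hom[OF p], of "\<lambda>k. s k - t k" t] d t
    by (simp add: padic_Cauchy_ring_def)
  from this[symmetric] show ?thesis using cl[OF t] cl[OF d]
    by (simp add: a_minus_def a_assoc r_neg)
qed

lemma padic_abs_tendsto_norm:
  assumes "prime p" "padic_Cauchy p s"
  shows "(\<lambda>k. padic_abs p (s k)) \<longlonglongrightarrow> padic_norm p (padic_class p s)"
proof -
  obtain L where L: "(\<lambda>k. padic_abs p (s k)) \<longlonglongrightarrow> L" using padic_Cauchy_convergent[OF assms] .
  have "padic_norm p (padic_class p s) = L"
    using assms L padic_class_self by (intro padic_norm_eqI[where s = s]) (auto simp: carrier_Qp)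
  thus ?thesis using L by simp
qed

lemma padic_class_finsum:
  assumes p: "prime p" and "finite I" and "\<And>i. i \<in> I \<Longrightarrow> padic_Cauchy p (s i)"
  shows "(\<Oplus>\<^bsub>Qp p\<^esub>i\<in>I. padic_class p (s i)) = padic_class p (\<lambda>k. \<Sum>i\<in>I. s i k)
         \<and> padic_Cauchy p (\<lambda>k. \<Sum>i\<in>I. s i k)"
  using assms(2,3)
proof (induction I rule: finite_induct)
  case empty
  interpret field "Qp p" by (rule field_Qp[OF p])
  have "\<zero>\<^bsub>Qp p\<^esub> = padic_class p (\<lambda>k. 0)"
    using padic_class_eq[of p "\<lambda>k. 0"] by (simp add: Qp_def FactRing_def)
  thus ?case by (simp add: padic_Cauchy_const)
next
  case (insert i I)
  interpret field "Qp p" by (rule field_Qp[OF p])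
  have cl: "padic_class p (s j) \<in> carrier (Qp p)" if "j \<in> insert i I" for j
    using insert.prems[OF that] by (auto simp: carrier_Qp)
  have IH: "(\<Oplus>\<^bsub>Qp p\<^esub>i\<in>I. padic_class p (s i)) = padic_class p (\<lambda>k. \<Sum>i\<in>I. s i k)"
    "padic_Cauchy p (\<lambda>k. \<Sum>i\<in>I. s i k)" using insert by auto
  have "(\<Oplus>\<^bsub>Qp p\<^esub>j\<in>insert i I. padic_class p (s j))
          = padic_class p (s i) \<oplus>\<^bsub>Qp p\<^esub> padic_class p (\<lambda>k. \<Sum>j\<in>I. s j k)"
    using insert.hyps cl by (subst finsum_insert) (auto simp: IH(1))
  also have "\<dots> = padic_class p (\<lambda>k. s i k + (\<Sum>j\<in>I. s j k))"
    using ring_hom_add[OF padic_class_ring_hom[OF p], of "s i" "\<lambda>k. \<Sum>j\<in>I. s j k"]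
      IH(2) insert.prems[of i] by (simp add: padic_Cauchy_ring_def)
  finally show ?case
    using insert.hyps padic_Cauchy_add[OF p insert.prems[of i] IH(2)] by simp
qed

lemma qform_padic_class:
  assumes p: "prime p" and s: "\<And>i. padic_Cauchy p (s i)"
  shows "qform_padic p A (\<chi> i. padic_class p (s i)) = padic_class p (\<lambda>k. qform A (\<chi> i. s i k))"
proof -
  have c1: "padic_Cauchy p (\<lambda>k. of_int (A $ i $ j) * s i k)" for i j
    by (rule padic_Cauchy_mult[OF p padic_Cauchy_const s])
  have c2: "padic_Cauchy p (\<lambda>k. of_int (A $ i $ j) * s i k * s j k)" for i j
    by (rule padic_Cauchy_mult[OF p c1 s])
  note inner = padic_class_finsum[OF p finite c2]
  have "qform_padic p A (\<chi> i. padic_class p (s i))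
     = (\<Oplus>\<^bsub>Qp p\<^esub>i\<in>UNIV. \<Oplus>\<^bsub>Qp p\<^esub>j\<in>UNIV. padic_class p (\<lambda>k. of_int (A $ i $ j) * s i k * s j k))"
    by (simp add: qform_padic_def padic_of_rat_def padic_class_mult[OF p] padic_Cauchy_const s c1)
  also have "\<dots> = (\<Oplus>\<^bsub>Qp p\<^esub>i\<in>UNIV. padic_class p (\<lambda>k. \<Sum>j\<in>UNIV. of_int (A $ i $ j) * s i k * s j k))"
    by (simp only: inner[THEN conjunct1])
  also have "\<dots> = padic_class p (\<lambda>k. qform A (\<chi> i. s i k))"
    unfolding qform_def vec_lambda_beta
    by (rule padic_class_finsum[OF p finite inner[THEN conjunct2], THEN conjunct1])
  finally show ?thesis .
qed

lemma padic_abs_of_int_le_1: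
  assumes "prime p"
  shows "padic_abs p (of_int k) \<le> 1"
proof (cases "k = 0")
  case False
  have "real p powi (- int (multiplicity (int p) k)) \<le> real p powi 0"
    using assms by (intro power_int_increasing) (auto simp: prime_ge_Suc_0_nat)
  thus ?thesis using padic_abs_frac[OF assms False, of 1] by simp
qed simp

lemma padic_abs_prime_power:
  assumes "prime p"
  shows "padic_abs p (of_int (int p ^ m)) = real p powi (- int m)"
proof -
  have "multiplicity (int p) (int p ^ m) = m"
    using assms prime_gt_1_nat[OF assms] by (intro multiplicity_same_power) auto
  thus ?thesis using padic_abs_frac[OF assms, of "int p ^ m" 1] assms by auto
qed

lemma padic_abs_of_int_le_imp_dvd:
  assumes "prime p" "padic_abs p (of_int k) \<le> real p powi (- int m)"
  shows "int p ^ m dvd k"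
proof (cases "k = 0")
  case False
  have p1: "real p > 1" using prime_gt_1_nat[OF assms(1)] by simp
  have "real p powi (- int (multiplicity (int p) k)) \<le> real p powi (- int m)"
    using assms padic_abs_frac[OF assms(1) False, of 1] by simp
  hence "m \<le> multiplicity (int p) k"
    using p1 by (metis linorder_not_le neg_less_iff_less of_nat_less_iff power_int_strict_increasing)
  thus ?thesis by (rule multiplicity_dvd')
qed simp

lemma padic_abs_sum_le:
  assumes "prime p" "e \<ge> 0" "\<And>i. i \<in> I \<Longrightarrow> padic_abs p (f i) \<le> e"
  shows "padic_abs p (sum f I) \<le> e"
  using assms(3)
proof (induction I rule: infinite_finite_induct)
  case (insert i I)
  thus ?case using padic_abs_add[OF assms(1), of "f i" "sum f I"] by fastforce
qed (use assms(2) in auto)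

lemma padic_abs_qform_le:
  assumes p: "prime p" and x: "\<And>i. padic_abs p (x $ i) \<le> e"
  shows "padic_abs p (qform A x) \<le> e\<^sup>2"
proof -
  have e: "e \<ge> 0" using x[of undefined] padic_abs_nonneg order_trans by blast
  have "padic_abs p (of_int (A $ i $ j)) * padic_abs p (x $ i) * padic_abs p (x $ j) \<le> 1 * e * e" for i j
    using e by (intro mult_mono x padic_abs_of_int_le_1[OF p]) auto
  thus ?thesis unfolding qform_def
    by (intro padic_abs_sum_le[OF p]) (auto simp: padic_abs_mult[OF p] power2_eq_square)
qed

lemma padic_norm_le_of_cong:
  assumes p: "prime p" and s: "padic_Cauchy p s"
    and cong: "padic_cong p m (padic_of_int p x) (padic_class p s)"
  shows "padic_norm p (padic_class p (\<lambda>k. of_int x - s k)) \<le> real p powi (- int m)"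
proof -
  obtain z where z: "z \<in> Zp p"
    "padic_of_int p x \<ominus>\<^bsub>Qp p\<^esub> padic_class p s = padic_of_int p (int p ^ m) \<otimes>\<^bsub>Qp p\<^esub> z"
    using cong by (auto simp: padic_cong_def)
  obtain u where u: "padic_Cauchy p u" "z = padic_class p u"
    using z(1) by (auto simp: Zp_def carrier_Qp)
  have c: "padic_Cauchy p (\<lambda>k. of_int (int p ^ m) * u k)"
    by (rule padic_Cauchy_mult[OF p padic_Cauchy_const u(1)])
  have eq: "padic_class p (\<lambda>k. of_int x - s k) = padic_class p (\<lambda>k. of_int (int p ^ m) * u k)"
    using z(2) unfolding u(2) padic_of_rat_def
    by (simp only: padic_class_diff[OF p padic_Cauchy_const s]
        padic_class_mult[OF p padic_Cauchy_const u(1)])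
  have "(\<lambda>k. padic_abs p (of_int (int p ^ m) * u k))
          \<longlonglongrightarrow> real p powi (- int m) * padic_norm p z"
    unfolding padic_abs_mult[OF p] padic_abs_prime_power[OF p] u(2)
    by (intro tendsto_mult_left padic_abs_tendsto_norm[OF p u(1)])
  hence "padic_norm p (padic_class p (\<lambda>k. of_int (int p ^ m) * u k))
          = real p powi (- int m) * padic_norm p z"
    using LIMSEQ_unique padic_abs_tendsto_norm[OF p c] by blast
  also have "\<dots> \<le> real p powi (- int m) * 1"
    using z(1) by (intro mult_left_mono) (auto simp: Zp_def)
  finally show ?thesis using eq by simp
qed

text \<open>
  Modulo \<open>p ^ m\<close> only \<open>X\<close> is prescribed, but \<open>polar A X q\<close> is then determined modulo \<open>p ^ (2 * m)\<close>,
  since \<open>X\<close> moves along a quadric: by \<open>qform_sub_scale\<close>,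
  \<open>a * (polar A X q - polar A Y q) = qform A (Y - a q) - qform A (X - a q)\<close>, the form takes values
  divisible by \<open>p ^ (2 * m)\<close> on vectors divisible by \<open>p ^ m\<close>, and \<open>a\<close> is a unit.
  The identity is used for rational approximations \<open>s k\<close> of \<open>a\<close>.
\<close>

lemma polar_cong_mod_square:
  fixes A :: "int ^ 'n ^ 'n" and X Y q :: "int ^ 'n"
  assumes p: "prime p" and a: "a \<in> carrier (Qp p)" "padic_norm p a = 1"
    and F: "qform A X = qform A Y"
    and X: "\<And>i. padic_cong p m (padic_of_int p (X $ i)) (a \<otimes>\<^bsub>Qp p\<^esub> padic_of_int p (q $ i))"
    and Y: "\<And>i. padic_cong p m (padic_of_int p (Y $ i)) (a \<otimes>\<^bsub>Qp p\<^esub> padic_of_int p (q $ i))"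
  shows "int p ^ (2 * m) dvd polar A X q - polar A Y q"
proof -
  obtain s where s: "padic_Cauchy p s" "a = padic_class p s" using a(1) by (auto simp: carrier_Qp)
  have sq: "padic_Cauchy p (\<lambda>k. s k * of_int (q $ i))" for i
    by (rule padic_Cauchy_mult[OF p s(1) padic_Cauchy_const])
  have aq: "a \<otimes>\<^bsub>Qp p\<^esub> padic_of_int p (q $ i) = padic_class p (\<lambda>k. s k * of_int (q $ i))" for i
    unfolding s(2) padic_of_rat_def by (rule padic_class_mult[OF p s(1) padic_Cauchy_const])
  define D where "D = polar A X q - polar A Y q"
  let ?R = "real p powi (- int m)"
  let ?v = "\<lambda>Z :: int ^ 'n. (\<chi> i. of_int (Z $ i)) :: rat ^ 'n"
  have close: "\<forall>\<^sub>F k in sequentially. \<forall>i. padic_abs p ((?v Z - s k *s ?v q) $ i) \<le> e"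
    if "e > ?R" and Z: "\<And>i. padic_cong p m (padic_of_int p (Z $ i)) (a \<otimes>\<^bsub>Qp p\<^esub> padic_of_int p (q $ i))"
    for e Z
  proof (rule eventually_all_finite)
    fix i
    have c: "padic_Cauchy p (\<lambda>k. of_int (Z $ i) - s k * of_int (q $ i))"
      using padic_Cauchy_add[OF p padic_Cauchy_const padic_Cauchy_uminus[OF sq]] by simp
    have "padic_norm p (padic_class p (\<lambda>k. of_int (Z $ i) - s k * of_int (q $ i))) < e"
      using padic_norm_le_of_cong[OF p sq Z[unfolded aq]] that(1) by (rule order.strict_trans1)
    from order_tendstoD(2)[OF padic_abs_tendsto_norm[OF p c] this]
    show "\<forall>\<^sub>F k in sequentially. padic_abs p ((?v Z - s k *s ?v q) $ i) \<le> e"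
      by (rule eventually_mono) simp
  qed
  \<comment> \<open>The congruences give bounds only in the limit, so the estimate is first made with any \<open>e > ?R\<close>.\<close>
  have bound: "padic_abs p (of_int D) \<le> e\<^sup>2" if e: "e > ?R" for e
  proof -
    have "padic_abs p (s k) * padic_abs p (of_int D) \<le> e\<^sup>2"
      if "\<forall>i. padic_abs p ((?v X - s k *s ?v q) $ i) \<le> e"
        "\<forall>i. padic_abs p ((?v Y - s k *s ?v q) $ i) \<le> e" for k
    proof -
      have "s k * of_int D = qform A (?v Y - s k *s ?v q) - qform A (?v X - s k *s ?v q)"
        by (simp add: qform_sub_scale qform_of_int polar_of_int F D_def algebra_simps)
      moreover have "padic_abs p (qform A (?v Y - s k *s ?v q)) \<le> e\<^sup>2"
        "padic_abs p (- qform A (?v X - s k *s ?v q)) \<le> e\<^sup>2"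
        using that by (auto intro!: padic_abs_qform_le[OF p])
      ultimately have "padic_abs p (s k * of_int D) \<le> e\<^sup>2"
        using padic_abs_add[OF p, of "qform A (?v Y - s k *s ?v q)" "- qform A (?v X - s k *s ?v q)"]
        by simp
      thus ?thesis by (simp add: padic_abs_mult[OF p])
    qed
    hence "\<forall>\<^sub>F k in sequentially. padic_abs p (s k) * padic_abs p (of_int D) \<le> e\<^sup>2"
      using eventually_conj[OF close[OF e X] close[OF e Y]] by (auto elim!: eventually_mono)
    moreover have "(\<lambda>k. padic_abs p (s k) * padic_abs p (of_int D)) \<longlonglongrightarrow> 1 * padic_abs p (of_int D)"
      using padic_abs_tendsto_norm[OF p s(1)] a(2) s(2) by (intro tendsto_mult_right) simp
    ultimately show ?thesis using tendsto_upperbound by fastforce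
  qed
  have R: "?R \<ge> 0" by simp
  have "padic_abs p (of_int D) \<le> ?R\<^sup>2"
  proof (rule ccontr)
    assume "\<not> ?thesis"
    hence "?R < sqrt (padic_abs p (of_int D))" using R by (simp add: real_less_rsqrt)
    then obtain e where e: "?R < e" "e < sqrt (padic_abs p (of_int D))" using dense by blast
    have "e\<^sup>2 < (sqrt (padic_abs p (of_int D)))\<^sup>2" using e R by (intro power_strict_mono) linarith+
    thus False using bound[OF e(1)] by simp
  qed
  also have "?R\<^sup>2 = real p powi (- int (2 * m))"
    using p power_int_add[of "real p" "- int m" "- int m"]
    by (simp add: power2_eq_square prime_gt_0_nat)
  finally show ?thesis unfolding D_def by (rule padic_abs_of_int_le_imp_dvd[OF p])
qed

lemma prod_prime_powers_dvd:
  fixes D :: int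
  assumes "finite S" "\<And>p. p \<in> S \<Longrightarrow> prime p" "\<And>p. p \<in> S \<Longrightarrow> int p ^ e p dvd D"
  shows "(\<Prod>p\<in>S. int p ^ e p) dvd D"
  using assms
proof (induction S rule: finite_induct)
  case (insert p S)
  have "coprime (int p ^ e p) (\<Prod>p\<in>S. int p ^ e p)"
  proof (rule prod_coprime_right)
    fix r assume "r \<in> S"
    hence "coprime (int p) (int r)"
      using insert.hyps insert.prems(1)[of p] insert.prems(1)[of r] by (intro primes_coprime) auto
    thus "coprime (int p ^ e p) (int r ^ e r)" by simp
  qed
  thus ?case using insert by (auto intro!: divides_mult)
qed simp

section \<open>Integral points in a global ball\<close>

text \<open>
  At the primes with \<open>\<nu> p \<noteq> 0\<close> the centre lies on the quadric since
  \<open>qform A (a q) = a\<^sup>2 * qform A q = N\<close>.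
\<close>

lemma is_global_ball_admissible_centre:
  fixes A :: "int ^ 'n ^ 'n" and q :: "int ^ 'n"
  assumes adm: "admissible A N q \<nu> a" and q: "qform A q > 0" and b: "b \<in> V1 A" and \<rho>: "\<rho> > 0"
  shows "is_global_ball A N (ball_at A r q \<nu> a\<lparr>centre_inf := b, radius := \<rho>\<rparr>)"
proof -
  have main: "a p \<otimes>\<^bsub>Qp p\<^esub> padic_of_int p (q $ i) \<in> Zp p"
    "\<nu> p \<noteq> 0 \<Longrightarrow> qform_padic p A (\<chi> i. a p \<otimes>\<^bsub>Qp p\<^esub> padic_of_int p (q $ i)) = padic_of_int p (int N)"
    if p: "prime p" for p i
  proof -
    interpret field "Qp p" by (rule field_Qp[OF p])
    have ap: "a p \<in> carrier (Qp p)" "padic_norm p (a p) \<le> 1"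
      using adm p by (auto simp: admissible_def Zp_def)
    obtain s where s: "padic_Cauchy p s" "a p = padic_class p s" using ap(1) by (auto simp: carrier_Qp)
    have sq: "padic_Cauchy p (\<lambda>k. s k * of_int (q $ i))" for i
      by (rule padic_Cauchy_mult[OF p s(1) padic_Cauchy_const])
    have aq: "a p \<otimes>\<^bsub>Qp p\<^esub> padic_of_int p (q $ i) = padic_class p (\<lambda>k. s k * of_int (q $ i))" for i
      unfolding s(2) padic_of_rat_def by (rule padic_class_mult[OF p s(1) padic_Cauchy_const])
    have "(\<lambda>k. padic_abs p (s k) * padic_abs p (of_int (q $ i)))
            \<longlonglongrightarrow> padic_norm p (a p) * padic_abs p (of_int (q $ i))"
      unfolding s(2) by (intro tendsto_mult_right padic_abs_tendsto_norm[OF p s(1)])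
    hence "padic_norm p (padic_class p (\<lambda>k. s k * of_int (q $ i)))
             = padic_norm p (a p) * padic_abs p (of_int (q $ i))"
      using LIMSEQ_unique padic_abs_tendsto_norm[OF p sq[of i]] by (simp add: padic_abs_mult[OF p]) blast
    also have "\<dots> \<le> 1 * 1"
      using ap(2) padic_abs_of_int_le_1[OF p] by (intro mult_mono) auto
    finally show "a p \<otimes>\<^bsub>Qp p\<^esub> padic_of_int p (q $ i) \<in> Zp p"
      unfolding aq Zp_def using sq by (auto simp: carrier_Qp)
    show "qform_padic p A (\<chi> i. a p \<otimes>\<^bsub>Qp p\<^esub> padic_of_int p (q $ i)) = padic_of_int p (int N)"
      if "\<nu> p \<noteq> 0"
    proof -
      let ?n = "of_int (qform A q) :: rat"
      have "a p [^]\<^bsub>Qp p\<^esub> (2::nat) = padic_of_rat p (of_nat N / ?n)"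
        using adm p that by (simp add: admissible_def)
      moreover have "a p [^]\<^bsub>Qp p\<^esub> (2::nat) = padic_class p (\<lambda>k. s k * s k)"
        using ap(1) padic_class_mult[OF p s(1) s(1)] by (simp add: numeral_2_eq_2 s(2))
      ultimately have null: "(\<lambda>k. s k * s k - of_nat N / ?n) \<in> padic_null p"
        by (simp add: padic_of_rat_def padic_class_eq_iff[OF p])
      have "qform A (\<chi> i. s k * of_int (q $ i)) - of_nat N = ?n * (s k * s k - of_nat N / ?n)" for k
      proof -
        have "(\<chi> i. s k * of_int (q $ i)) = s k *s (\<chi> i. of_int (q $ i))"
          by (simp add: vec_eq_iff)
        thus ?thesis using q by (simp add: qform_scale qform_of_int power2_eq_square algebra_simps)
      qed
      hence "(\<lambda>k. qform A (\<chi> i. s k * of_int (q $ i)) - of_nat N) \<in> padic_null p"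
        using padic_null_mult[OF p null padic_Cauchy_const[of p ?n]] by simp
      thus ?thesis
        unfolding aq qform_padic_class[OF p sq] by (simp add: padic_of_rat_def padic_class_eq_iff[OF p])
    qed
  qed
  thus ?thesis using adm b \<rho> by (auto simp: is_global_ball_def ball_at_def admissible_def)
qed

lemma prod_prime_powers_pos: "0 < (\<Prod>p | prime p \<and> \<nu> p \<noteq> 0. p ^ \<nu> p :: nat)"
  by (intro prod_pos) (auto simp: prime_gt_0_nat)

lemma ball_norm_eq_divide:
  "ball_norm B = radius B / real (\<Prod>p | prime p \<and> expo B p \<noteq> 0. p ^ expo B p)"
  by (simp add: ball_norm_def power_int_minus prod_inversef[symmetric] divide_inverse)

text \<open>
  Integral points only meet one residue class of \<open>polar A X q\<close> modulo \<open>M\<^sup>2\<close>.  The real centre and radius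
  may vary, because the class depends on the conditions at the primes alone.
\<close>

lemma polar_integral_points_cong:
  fixes A :: "int ^ 'n ^ 'n" and q :: "int ^ 'n"
  assumes adm: "admissible A N q \<nu> a"
  defines "M \<equiv> \<Prod>p | prime p \<and> \<nu> p \<noteq> 0. p ^ \<nu> p"
  obtains \<tau> where "\<And>b \<rho> X.
      X \<in> integral_points A nrm N (ball_at A r q \<nu> a\<lparr>centre_inf := b, radius := \<rho>\<rparr>)
        \<Longrightarrow> (int M)\<^sup>2 dvd polar A X q - \<tau>"
proof -
  let ?I = "\<Union>b \<rho>. integral_points A nrm N (ball_at A r q \<nu> a\<lparr>centre_inf := b, radius := \<rho>\<rparr>)"
  have *: "(int M)\<^sup>2 dvd polar A X q - polar A Y q" if X: "X \<in> ?I" and Y: "Y \<in> ?I" for X Y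
  proof -
    let ?S = "{p. prime p \<and> \<nu> p \<noteq> 0}"
    have "(int M)\<^sup>2 = (\<Prod>p\<in>?S. int p ^ (2 * \<nu> p))"
      by (simp add: M_def power_mult mult.commute[of 2] flip: prod_power_distrib)
    also have "\<dots> dvd polar A X q - polar A Y q"
    proof (rule prod_prime_powers_dvd)
      show "finite ?S" using adm by (simp add: admissible_def)
      fix p assume p: "p \<in> ?S"
      hence a: "a p \<in> carrier (Qp p)" "padic_norm p (a p) = 1"
        using adm by (auto simp: admissible_def Zp_def)
      show "int p ^ (2 * \<nu> p) dvd polar A X q - polar A Y q"
        by (rule polar_cong_mod_square[OF _ a]) (use p X Y in \<open>auto simp: integral_points_def ball_at_def\<close>)
    qed simp
    finally show ?thesis .
  qed
  show ?thesis
  proof (cases "?I = {}")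
    case True
    show ?thesis by (rule that[of 0]) (use True in blast)
  next
    case False
    then obtain Y where "Y \<in> ?I" by blast
    show ?thesis by (rule that[of "polar A Y q"]) (use *[OF _ \<open>Y \<in> ?I\<close>] in blast)
  qed
qed

section \<open>Holes around rational points of the quadric\<close>

theorem theorem1p8:
  fixes A :: "int ^ 'n ^ 'n"
    and nrm :: "real ^ 'n \<Rightarrow> real"
    and \<Omega> :: "(real ^ 'n) set"
  assumes "CARD('n) \<ge> 4"
    and "nondegenerate A"
    and "is_norm nrm"
    and "compact \<Omega>" and "\<Omega> \<subseteq> V1 A"
  shows "\<exists>c1 c2 :: real. c1 > 0 \<and> c2 > 0 \<and>
    (\<forall>(N::nat) (r::real) (q :: int ^ 'n) (\<nu> :: nat \<Rightarrow> nat) (a :: nat \<Rightarrow> padic).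
       N \<ge> 1 \<longrightarrow> 0 < r \<longrightarrow> r < 1 \<longrightarrow>
       primitive q \<longrightarrow> qform A q > 0 \<longrightarrow>
       (1 / sqrt (of_int (qform A q))) *\<^sub>R real_vec q \<in> \<Omega> \<longrightarrow>
       admissible A N q \<nu> a \<longrightarrow>
       ball_norm (ball_at A r q \<nu> a)
         \<ge> c1 * (real N powr (- 1 / 4) / nrm (real_vec q) powr (1 / 2)) \<longrightarrow>
       (\<exists>B'. is_global_ball A N B' \<and>
             ball_set nrm B' \<subseteq> ball_set nrm (ball_at A r q \<nu> a) \<and>
             integral_points A nrm N B' = {} \<and>
             ball_norm B' > c2 * (real N powr (- 1 / 4) / nrm (real_vec q) powr (1 / 2))))"
proof -
  have card: "CARD('n) \<ge> 2" using assms(1) by simp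
  obtain C \<delta> where C: "C > 0" "\<delta> > 0" and hole: "\<And>e g t. e \<in> \<Omega> \<Longrightarrow> 0 < g \<Longrightarrow> g \<le> 1 \<Longrightarrow>
       \<exists>b\<in>V1 A. nrm (b - e) \<le> C * sqrt g \<and>
         (\<forall>x k. nrm (x - b) \<le> \<delta> * sqrt g \<longrightarrow> qform A (x - e) \<noteq> t + g * of_int k)"
    using hole_in_quadric[OF card assms(2-5)] by metis
  obtain m E where mE: "m > 0" "E > 0" "\<And>e. e \<in> \<Omega> \<Longrightarrow> m \<le> nrm e \<and> nrm e \<le> E"
    using is_norm_bounds_on_quadric[OF assms(3-5)] by metis
  define c1 where "c1 = sqrt E * (C + \<delta> + 1)"
  define c2 where "c2 = \<delta> * sqrt m / 2"
  show ?thesis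
  proof (rule exI[of _ c1], rule exI[of _ c2], intro conjI allI impI)
    show "c1 > 0" "c2 > 0" using C mE by (simp_all add: c1_def c2_def)
    fix N :: nat and r :: real and q :: "int ^ 'n" and \<nu> :: "nat \<Rightarrow> nat" and a :: "nat \<Rightarrow> padic"
    assume N: "N \<ge> 1" and r: "0 < r" "r < 1" and q: "qform A q > 0"
      and e\<Omega>: "(1 / sqrt (of_int (qform A q))) *\<^sub>R real_vec q \<in> \<Omega>"
      and adm: "admissible A N q \<nu> a"
      and large: "c1 * (real N powr (- 1 / 4) / nrm (real_vec q) powr (1 / 2))
                    \<le> ball_norm (ball_at A r q \<nu> a)"
    \<comment> \<open>The constant \<open>c1\<close> makes \<open>s\<close> small compared with \<open>r\<close>, so that the hole, at distance and of radius
      \<open>O(s)\<close>, fits into the given ball; the gap \<open>g = s\<^sup>2\<close> equals \<open>M\<^sup>2 / sqrt (N * n)\<close>.\<close>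
    define T where "T = real N powr (- 1 / 4) / nrm (real_vec q) powr (1 / 2)"
    define n where "n = real_of_int (qform A q)"
    define e where "e = (1 / sqrt n) *\<^sub>R real_vec q"
    define M where "M = (\<Prod>p | prime p \<and> \<nu> p \<noteq> 0. p ^ \<nu> p)"
    define s where "s = real M * T * sqrt (nrm e)"
    define g where "g = s\<^sup>2"
    have n: "n > 0" using q by (simp add: n_def)
    have M: "real M > 0" using prod_prime_powers_pos[of \<nu>] unfolding M_def of_nat_0_less_iff .
    have e: "e \<in> \<Omega>" using e\<Omega> by (simp add: e_def n_def)
    have nrme: "m \<le> nrm e" "nrm e \<le> E" "nrm e > 0" using mE(3)[OF e] mE(1) by auto
    have qe: "real_vec q = sqrt n *\<^sub>R e" using n by (simp add: e_def)
    have nrmq: "nrm (real_vec q) = sqrt n * nrm e"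
      using assms(3) n unfolding qe is_norm_def by simp
    have T: "T > 0" using N n nrme by (simp add: T_def nrmq)
    have s: "s > 0" using M T nrme by (simp add: s_def)
    have "T\<^sup>2 = 1 / (sqrt (real N) * (sqrt n * nrm e))"
    proof -
      have "(real N powr (- 1 / 4))\<^sup>2 = real N powr (- (1 / 2))"
        by (simp add: power2_eq_square flip: powr_add)
      also have "\<dots> = 1 / sqrt (real N)" by (simp add: powr_minus_divide powr_half_sqrt)
      finally show ?thesis using n nrme
        by (simp add: T_def nrmq power_divide powr_half_sqrt)
    qed
    hence g: "g = (real M)\<^sup>2 / (sqrt (real N) * sqrt n)"
      using nrme by (simp add: g_def s_def power_mult_distrib)
    have norm_eq: "ball_norm (ball_at A r q \<nu> a) = r / real M"
      by (simp add: ball_norm_eq_divide ball_at_def M_def)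
    have "c1 * T * real M \<le> r"
      using large M unfolding norm_eq T_def[symmetric] by (simp add: pos_le_divide_eq)
    moreover have "(C + \<delta> + 1) * s \<le> c1 * T * real M"
    proof -
      have "(C + \<delta> + 1) * (real M * T) * sqrt (nrm e) \<le> (C + \<delta> + 1) * (real M * T) * sqrt E"
        using C M T nrme by (intro mult_left_mono) auto
      thus ?thesis by (simp add: s_def c1_def mult_ac)
    qed
    ultimately have sr: "(C + \<delta> + 1) * s \<le> r" by linarith
    hence "C * s + \<delta> * s \<le> r" using s by (simp add: algebra_simps)
    have "s \<le> (C + \<delta> + 1) * s" using C s by simp
    hence "s \<le> 1" using sr r by linarith
    hence g01: "0 < g" "g \<le> 1" using s by (auto simp: g_def power_le_one)
    have sqg: "sqrt g = s" using s by (simp add: g_def)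
    \<comment> \<open>The class of \<open>\<tau>\<close> is needed before \<open>b\<close> can be chosen, hence the generality in \<open>b\<close> and \<open>\<rho>\<close>.\<close>
    obtain \<tau> where \<tau>: "\<And>b \<rho> X. X \<in> integral_points A nrm N (ball_at A r q \<nu> a\<lparr>centre_inf := b, radius := \<rho>\<rparr>)
        \<Longrightarrow> (int M)\<^sup>2 dvd polar A X q - \<tau>"
      using polar_integral_points_cong[OF adm, folded M_def] by blast
    obtain b where b: "b \<in> V1 A" "nrm (b - e) \<le> C * s"
      "\<And>x k. nrm (x - b) \<le> \<delta> * s \<Longrightarrow>
         qform A (x - e) \<noteq> (2 - of_int \<tau> / (sqrt (real N) * sqrt n)) + g * of_int k"
      using hole[OF e g01, of "2 - of_int \<tau> / (sqrt (real N) * sqrt n)"] unfolding sqg by blast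
    let ?B = "ball_at A r q \<nu> a\<lparr>centre_inf := b, radius := \<delta> * s\<rparr>"
    show "\<exists>B'. is_global_ball A N B' \<and>
             ball_set nrm B' \<subseteq> ball_set nrm (ball_at A r q \<nu> a) \<and>
             integral_points A nrm N B' = {} \<and>
             ball_norm B' > c2 * (real N powr (- 1 / 4) / nrm (real_vec q) powr (1 / 2))"
    proof (intro exI[of _ ?B] conjI)
      show "is_global_ball A N ?B"
        using is_global_ball_admissible_centre[OF adm q b(1)] C s by simp
      have "real_ball nrm b (\<delta> * s) \<subseteq> real_ball nrm e r"
      proof
        fix x assume "x \<in> real_ball nrm b (\<delta> * s)"
        moreover have "nrm (x - e) \<le> nrm (x - b) + nrm (b - e)"
          using assms(3) unfolding is_norm_def by (metis diff_add_cancel add_diff_eq)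
        ultimately show "x \<in> real_ball nrm e r"
          using b(2) \<open>C * s + \<delta> * s \<le> r\<close> by (simp add: real_ball_def)
      qed
      thus "ball_set nrm ?B \<subseteq> ball_set nrm (ball_at A r q \<nu> a)"
        by (auto simp: ball_set_def ball_at_def e_def n_def)
      show "integral_points A nrm N ?B = {}"
      proof (rule equals0I)
        fix X assume X: "X \<in> integral_points A nrm N ?B"
        obtain k where k: "polar A X q = \<tau> + (int M)\<^sup>2 * k"
          using \<tau>[OF X] by (metis dvdE diff_add_cancel add.commute)
        define x where "x = (1 / sqrt (real N)) *\<^sub>R real_vec X"
        have x: "nrm (x - b) \<le> \<delta> * s" "qform A X = int N"
          using X by (auto simp: integral_points_def real_ball_def x_def)
        have Fx: "qform A x = 1"
          using qform_of_int[of A X, where 'a = real] N x(2)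
          by (simp add: x_def real_vec_def power_divide qform_scale flip: scalar_mult_eq_scaleR)
        have Fe: "qform A e = 1" using e assms(5) by (auto simp: V1_def)
        \<comment> \<open>The height \<open>qform A (x - e) = 2 - polar A x e\<close> of an integral point lies in the progression
          avoided by the hole.\<close>
        have "polar A x e = of_int (polar A X q) / (sqrt (real N) * sqrt n)"
          using polar_of_int[of A X q, where 'a = real]
          by (simp add: x_def e_def real_vec_def polar_scale_left polar_scale_right
              flip: scalar_mult_eq_scaleR)
        also have "\<dots> = of_int \<tau> / (sqrt (real N) * sqrt n) + g * of_int k"
          by (simp add: k g add_divide_distrib)
        finally have "qform A (x - e)
            = (2 - of_int \<tau> / (sqrt (real N) * sqrt n)) + g * of_int (- k)"
          using qform_sub_scale[of A x 1 e] Fx Fe by simp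
        thus False using b(3)[OF x(1), of "- k"] by simp
      qed
      have norm_eqB: "ball_norm ?B = \<delta> * s / real M"
        by (simp add: ball_norm_eq_divide ball_at_def M_def)
      have "c2 * T < \<delta> * sqrt m * T" using C mE(1) T by (simp add: c2_def)
      also have "\<dots> \<le> \<delta> * sqrt (nrm e) * T"
        using C T nrme by (intro mult_right_mono mult_left_mono) auto
      also have "\<dots> = ball_norm ?B"
        using M norm_eqB by (simp add: s_def)
      finally show "ball_norm ?B > c2 * (real N powr (- 1 / 4) / nrm (real_vec q) powr (1 / 2))"
        by (simp add: T_def)
    qed
  qed
qed

end
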